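(* Let $F$ be a field of characteristic different from $5$ containing a primitive $5$th root of unity $\rho$, and let $A$ be a cyclic algebra of degree $5$ over $F$. Let $x, z \in A$ be Kummer elements. If $w(x,z)=2$ and $0 \notin l(z,x)$, then $x$ and $z$ are connected by a sequence of edges of weight $1$, i.e. there are an integer $n \ge 1$ and Kummer elements $x=u_0,u_1,\dots,u_n=z$ in $A$ with $w(u_{t},u_{t+1})=1$ for all $0 \le t \le n-1$.
   Context: Here $p=5$. A cyclic algebra of degree $p$ over $F$ is an algebra of the form $F[x,y : x^p=\alpha,\ y^p=\beta,\ yx=\rho xy]$ with $\alpha,\beta \in F^\times$. A Kummer element of $A$ is an element $x \in A \setminus F$ with $x^p \in F^\times$; let $\mathcal{X}$ be the set of Kummer elements of $A$. For $x \in \mathcal{X}$, every $z \in A$ has a unique decomposition $z=z_0+z_1+\dots+z_{p-1}$ with $z_i x=\rho^i x z_i$ for each $0 \le i \le p-1$. For $x,z \in \mathcal{X}$ the label is $l(x,z)=\{0 \le i \le p-1 : z_i \neq 0\}$ (indices are regarded as elements of $\mathbb{Z}/p\mathbb{Z}$), and the weight is $w(x,z)=\# l(x,z)$. One has $w(x,z)=1$ if and only if $w(z,x)=1$. *)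

theory Defs
  imports Complex_Main "HOL-Library.Poly_Mapping"
begin

section \<open>Associative algebras over a field\<close>

text \<open>
  An associative unital algebra over a field, given by its scalar multiplication. It need not be
  commutative, but it is nonzero since the ring type has class \<open>ring_1\<close>.
\<close>

locale assoc_algebra = vector_space scale
  for scale :: "'f::field \<Rightarrow> 'a::ring_1 \<Rightarrow> 'a" +
  assumes scale_mult_left: "scale c a * b = scale c (a * b)"
    and scale_mult_right: "a * scale c b = scale c (a * b)"

definition two_sided_ideal :: "'r::ring_1 set \<Rightarrow> bool" where
  "two_sided_ideal I \<longleftrightarrow>
     0 \<in> I \<and> (\<forall>a\<in>I. \<forall>b\<in>I. a + b \<in> I) \<and> (\<forall>a\<in>I. \<forall>r. r * a \<in> I \<and> a * r \<in> I)"


section \<open>The free algebra on two generators\<close>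

text \<open>
  The monoid of words in two letters is written additively, because \<open>Poly_Mapping\<close> equips
  \<open>'m \<Rightarrow>\<^sub>0 'f\<close> with the convolution product for \<open>'m\<close> of class \<open>monoid_add\<close>. Hence
  \<open>free_word \<Rightarrow>\<^sub>0 'f\<close> is the (noncommutative) free algebra over \<open>'f\<close> on \<open>GenX\<close> and \<open>GenY\<close>.
\<close>

datatype gen = GenX | GenY

datatype free_word = Word (letters: "gen list")

instantiation free_word :: monoid_add
begin

definition zero_free_word :: free_word where
  "0 = Word []"

definition plus_free_word :: "free_word \<Rightarrow> free_word \<Rightarrow> free_word" where
  "u + v = Word (letters u @ letters v)"

instance
  by standard (simp_all add: zero_free_word_def plus_free_word_def)

end

definition free_const :: "'f \<Rightarrow> free_word \<Rightarrow>\<^sub>0 'f::field" where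
  "free_const c = Poly_Mapping.single 0 c"

definition free_X :: "free_word \<Rightarrow>\<^sub>0 'f::field" where
  "free_X = Poly_Mapping.single (Word [GenX]) 1"

definition free_Y :: "free_word \<Rightarrow>\<^sub>0 'f::field" where
  "free_Y = Poly_Mapping.single (Word [GenY]) 1"

definition word_eval :: "'a::monoid_mult \<Rightarrow> 'a \<Rightarrow> free_word \<Rightarrow> 'a" where
  "word_eval x y w = prod_list (map (\<lambda>g. case g of GenX \<Rightarrow> x | GenY \<Rightarrow> y) (letters w))"

definition free_eval ::
    "('f::field \<Rightarrow> 'a::ring_1 \<Rightarrow> 'a) \<Rightarrow> 'a \<Rightarrow> 'a \<Rightarrow> (free_word \<Rightarrow>\<^sub>0 'f) \<Rightarrow> 'a" where
  "free_eval scale x y f =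
     (\<Sum>w\<in>Poly_Mapping.keys f. scale (Poly_Mapping.lookup f w) (word_eval x y w))"


section \<open>Cyclic algebras\<close>

definition primitive_root_of_unity :: "nat \<Rightarrow> 'f::field \<Rightarrow> bool" where
  "primitive_root_of_unity n \<rho> \<longleftrightarrow> \<rho> ^ n = 1 \<and> (\<forall>k. 0 < k \<and> k < n \<longrightarrow> \<rho> ^ k \<noteq> 1)"

definition cyclic_relators :: "nat \<Rightarrow> 'f::field \<Rightarrow> 'f \<Rightarrow> 'f \<Rightarrow> (free_word \<Rightarrow>\<^sub>0 'f) set" where
  "cyclic_relators p \<rho> \<alpha> \<beta> =
     {free_X ^ p - free_const \<alpha>,
      free_Y ^ p - free_const \<beta>,
      free_Y * free_X - free_const \<rho> * free_X * free_Y}"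

text \<open>
  The algebra is \<open>F[x, y : x\<^sup>p = \<alpha>, y\<^sup>p = \<beta>, y x = \<rho> x y]\<close>: it is generated by \<open>x\<close> and \<open>y\<close>, and the
  relations between \<open>x\<close> and \<open>y\<close> are exactly the consequences of the three displayed ones.
\<close>

definition cyclic_algebra :: "('f::field \<Rightarrow> 'a::ring_1 \<Rightarrow> 'a) \<Rightarrow> nat \<Rightarrow> 'f \<Rightarrow> bool" where
  "cyclic_algebra scale p \<rho> \<longleftrightarrow>
     assoc_algebra scale \<and>
     (\<exists>\<alpha> \<beta> x y. \<alpha> \<noteq> 0 \<and> \<beta> \<noteq> 0 \<and>
        surj (free_eval scale x y) \<and>
        {f. free_eval scale x y f = 0} = two_sided_ideal hull cyclic_relators p \<rho> \<alpha> \<beta>)"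


section \<open>Kummer elements, labels and weights\<close>

definition kummer_elements :: "('f::field \<Rightarrow> 'a::ring_1 \<Rightarrow> 'a) \<Rightarrow> nat \<Rightarrow> 'a set" where
  "kummer_elements scale p =
     {x. x \<notin> range (\<lambda>c. scale c 1) \<and> (\<exists>c. c \<noteq> 0 \<and> x ^ p = scale c 1)}"

text \<open>
  The components of \<open>z\<close> are indexed by the representatives \<open>0, \<dots>, p - 1\<close> of the residues modulo \<open>p\<close>;
  a decomposition is extended by \<open>0\<close> outside this range so that it is unique as a function.
\<close>

definition is_decomposition ::
    "('f::field \<Rightarrow> 'a::ring_1 \<Rightarrow> 'a) \<Rightarrow> nat \<Rightarrow> 'f \<Rightarrow> 'a \<Rightarrow> 'a \<Rightarrow> (nat \<Rightarrow> 'a) \<Rightarrow> bool" where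
  "is_decomposition scale p \<rho> x z d \<longleftrightarrow>
     z = (\<Sum>i<p. d i) \<and> (\<forall>i<p. d i * x = scale (\<rho> ^ i) (x * d i)) \<and> (\<forall>i\<ge>p. d i = 0)"

definition decomposition ::
    "('f::field \<Rightarrow> 'a::ring_1 \<Rightarrow> 'a) \<Rightarrow> nat \<Rightarrow> 'f \<Rightarrow> 'a \<Rightarrow> 'a \<Rightarrow> nat \<Rightarrow> 'a" where
  "decomposition scale p \<rho> x z = (THE d. is_decomposition scale p \<rho> x z d)"

definition label ::
    "('f::field \<Rightarrow> 'a::ring_1 \<Rightarrow> 'a) \<Rightarrow> nat \<Rightarrow> 'f \<Rightarrow> 'a \<Rightarrow> 'a \<Rightarrow> nat set" where
  "label scale p \<rho> x z = {i. i < p \<and> decomposition scale p \<rho> x z i \<noteq> 0}"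

definition weight ::
    "('f::field \<Rightarrow> 'a::ring_1 \<Rightarrow> 'a) \<Rightarrow> nat \<Rightarrow> 'f \<Rightarrow> 'a \<Rightarrow> 'a \<Rightarrow> nat" where
  "weight scale p \<rho> x z = card (label scale p \<rho> x z)"

lemma sum_powers_root_of_unity:
  fixes t :: "'f::field"
  assumes "t ^ p = 1" "t \<noteq> 1"
  shows "(\<Sum>j<p. t ^ j) = 0"
  using assms by (simp add: geometric_sum)

lemma sum_lessThan_shift_periodic:
  fixes g :: "nat \<Rightarrow> 'a::ab_group_add"
  assumes "g p = g 0"
  shows "(\<Sum>j<p. g (Suc j)) = (\<Sum>j<p. g j)"
proof -
  have "(\<Sum>j<p. g (Suc j)) - (\<Sum>j<p. g j) = g p - g 0"
    by (simp add: sum_lessThan_telescope flip: sum_subtractf)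
  then show ?thesis using assms by simp
qed

text \<open>The description in \<open>decomposition\<close> is well-defined:\<close>

lemma ex1_decomposition:
  fixes scale :: "'f::field \<Rightarrow> 'a::ring_1 \<Rightarrow> 'a"
  assumes alg: "assoc_algebra scale"
    and p: "of_nat p \<noteq> (0::'f)"
    and rho: "primitive_root_of_unity p \<rho>"
    and x: "x \<in> kummer_elements scale p"
  shows "\<exists>!d. is_decomposition scale p \<rho> x z d"
proof -
  interpret assoc_algebra scale by (rule alg)
  have p0: "p > 0" using p by (cases p) auto
  have rp: "\<rho> ^ p = 1" and rk: "\<And>k. 0 < k \<Longrightarrow> k < p \<Longrightarrow> \<rho> ^ k \<noteq> 1"
    using rho by (auto simp: primitive_root_of_unity_def)
  have r0: "\<rho> \<noteq> 0" using rp p0 by (metis power_0_left neq0_conv zero_neq_one)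
  obtain c where c: "c \<noteq> 0" "x ^ p = scale c 1"
    using x by (auto simp: kummer_elements_def)
  define x' where "x' = scale (inverse c) (x ^ (p - 1))"
  have xx': "x * x' = 1" and x'x: "x' * x = 1"
    using c p0 by (auto simp: x'_def scale_mult_left scale_mult_right
        simp flip: power_Suc power_Suc2)
  define T where "T j w = x' ^ j * w * x ^ j" for j and w :: 'a
  have x'p: "x' ^ j * x ^ j = 1" for j
  proof (induction j)
    case (Suc j)
    have "x' ^ Suc j * x ^ Suc j = x' ^ j * (x' * x) * x ^ j"
      by (simp only: power_Suc2[of x'] power_Suc[of x] mult.assoc)
    then show ?case using Suc x'x by simp
  qed simp
  have x'pp: "x' ^ p = scale (inverse c) 1"
  proof -
    have "scale (inverse c) (x' ^ p * x ^ p) = x' ^ p"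
      using c by (simp add: scale_mult_right)
    then show ?thesis using x'p[of p] by simp
  qed
  have T0: "T 0 w = w" for w by (simp add: T_def)
  have Tp: "T p w = w" for w
    using c by (simp add: T_def x'pp scale_mult_left scale_mult_right)
  have TSuc: "x * T (Suc j) w = T j w * x" for j w
  proof -
    have "x * T (Suc j) w = (x * x') * x' ^ j * w * x ^ j * x"
      by (simp only: T_def power_Suc2[of x] power_Suc[of x'] mult.assoc)
    then show ?thesis using xx' by (simp add: T_def)
  qed
  have Teig: "T j w = scale (\<mu> ^ j) w" if "w * x = scale \<mu> (x * w)" for j w \<mu>
  proof (induction j)
    case (Suc j)
    have "T (Suc j) w = x' * (x * T (Suc j) w)"
      using x'x by (simp flip: mult.assoc)
    also have "\<dots> = x' * (scale (\<mu> ^ j) w * x)" by (simp add: TSuc Suc)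
    also have "\<dots> = scale (\<mu> ^ Suc j) (x' * x * w)"
      using that by (simp add: scale_mult_left scale_mult_right mult.assoc mult.commute)
    finally show ?case using x'x by simp
  qed (simp add: T0)
  have Tsum: "T j (sum f A) = (\<Sum>i\<in>A. T j (f i))" for j f and A :: "nat set"
    by (simp add: T_def sum_distrib_left sum_distrib_right)
  define P where
    "P k w = scale (inverse (of_nat p)) (\<Sum>j<p. scale (inverse \<rho> ^ (k * j)) (T j w))" for k w
  have orth: "(\<Sum>j<p. (inverse \<rho> ^ k * \<rho> ^ i) ^ j) = (if i = k then of_nat p else 0)"
    if "i < p" "k < p" for i k
  proof (cases "i = k")
    case True
    then show ?thesis using r0 by (simp flip: power_mult_distrib)
  next
    case False
    have "inverse \<rho> ^ k * \<rho> ^ i \<noteq> 1"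
    proof
      assume "inverse \<rho> ^ k * \<rho> ^ i = 1"
      then have eq: "\<rho> ^ i = \<rho> ^ k" using r0 by (simp add: field_simps)
      have aux: False if "a < b" "b < p" "\<rho> ^ a = \<rho> ^ b" for a b
      proof -
        have "\<rho> ^ a * \<rho> ^ (b - a) = \<rho> ^ a * 1"
          using that by (subst power_add[symmetric]) simp
        then have "\<rho> ^ (b - a) = 1" using r0 by simp
        then show False using rk[of "b - a"] that by simp
      qed
      show False using aux[of i k] aux[of k i] eq False that by (cases "i < k") auto
    qed
    moreover have "(inverse \<rho> ^ k * \<rho> ^ i) ^ p = 1"
    proof -
      have "(inverse \<rho> ^ k * \<rho> ^ i) ^ p = inverse (\<rho> ^ p) ^ k * (\<rho> ^ p) ^ i"
        by (simp add: power_mult_distrib power_inverse mult.commute flip: power_mult)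
      then show ?thesis using rp by simp
    qed
    ultimately show ?thesis using False by (simp add: sum_powers_root_of_unity)
  qed
  have ex: "is_decomposition scale p \<rho> x z (\<lambda>k. if k < p then P k z else 0)"
    unfolding is_decomposition_def
  proof (intro conjI allI impI)
    have "(\<Sum>k<p. P k z)
        = scale (inverse (of_nat p)) (\<Sum>j<p. scale (\<Sum>k<p. inverse \<rho> ^ (k * j)) (T j z))"
      unfolding P_def scale_sum_right[symmetric] by (subst sum.swap) (simp add: scale_sum_left)
    also have "(\<Sum>j<p. scale (\<Sum>k<p. inverse \<rho> ^ (k * j)) (T j z))
        = (\<Sum>j<p. if j = 0 then scale (of_nat p) (T j z) else 0)"
    proof (rule sum.cong[OF refl])
      fix j assume "j \<in> {..<p}"
      then have "(\<Sum>k<p. inverse \<rho> ^ (k * j)) = (if j = 0 then of_nat p else 0)"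
        using orth[of 0 j] p0 by (simp add: mult.commute flip: power_mult split: if_splits)
      then show "scale (\<Sum>k<p. inverse \<rho> ^ (k * j)) (T j z)
          = (if j = 0 then scale (of_nat p) (T j z) else 0)" by simp
    qed
    finally show "z = (\<Sum>k<p. if k < p then P k z else 0)"
      using p p0 by (simp add: T0)
  next
    fix i assume i: "i < p"
    define g where "g j = scale (inverse \<rho> ^ (i * j)) (T j z)" for j
    have gp: "g p = g 0"
    proof -
      have "inverse \<rho> ^ (i * p) = inverse (\<rho> ^ p) ^ i"
        by (simp add: power_inverse mult.commute flip: power_mult)
      then show ?thesis using rp by (simp add: g_def T0 Tp)
    qed
    have step: "g j * x = scale (\<rho> ^ i) (x * g (Suc j))" for j
    proof -
      have "\<rho> ^ i * inverse \<rho> ^ (i * Suc j) = inverse \<rho> ^ (i * j)"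
        using r0 by (simp add: power_add power_inverse)
      then show ?thesis by (simp add: g_def scale_mult_left scale_mult_right TSuc)
    qed
    have "P i z * x = scale (inverse (of_nat p)) (\<Sum>j<p. g j * x)"
      by (simp add: P_def g_def scale_mult_left sum_distrib_right)
    also have "(\<Sum>j<p. g j * x) = scale (\<rho> ^ i) (x * (\<Sum>j<p. g (Suc j)))"
      by (simp add: step scale_sum_right sum_distrib_left)
    also have "(\<Sum>j<p. g (Suc j)) = (\<Sum>j<p. g j)"
      by (rule sum_lessThan_shift_periodic[of g, OF gp])
    finally have "P i z * x = scale (\<rho> ^ i) (x * P i z)"
      by (simp add: P_def g_def scale_mult_right mult.commute)
    then show "(if i < p then P i z else 0) * x
        = scale (\<rho> ^ i) (x * (if i < p then P i z else 0))"
      using i by simp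
  qed simp
  have uniq: "d = (\<lambda>k. if k < p then P k z else 0)" if d: "is_decomposition scale p \<rho> x z d" for d
  proof
    fix k
    show "d k = (if k < p then P k z else 0)"
    proof (cases "k < p")
      case k: True
      have z: "z = (\<Sum>i<p. d i)" using d by (simp add: is_decomposition_def)
      have Td: "T j (d i) = scale ((\<rho> ^ i) ^ j) (d i)" if "i < p" for i j
        using d that by (intro Teig) (simp add: is_decomposition_def)
      have "(\<Sum>j<p. scale (inverse \<rho> ^ (k * j)) (T j z))
          = (\<Sum>j<p. \<Sum>i<p. scale ((inverse \<rho> ^ k * \<rho> ^ i) ^ j) (d i))"
        unfolding z by (intro sum.cong refl)
          (simp add: Tsum Td scale_sum_right power_mult_distrib power_mult)
      also have "\<dots> = (\<Sum>i<p. scale (\<Sum>j<p. (inverse \<rho> ^ k * \<rho> ^ i) ^ j) (d i))"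
        by (subst sum.swap) (simp add: scale_sum_left)
      also have "\<dots> = (\<Sum>i<p. if i = k then scale (of_nat p) (d i) else 0)"
        by (intro sum.cong refl) (simp add: orth k)
      also have "\<dots> = scale (of_nat p) (d k)" using k by simp
      finally show ?thesis using k p by (simp add: P_def)
    next
      case False
      then show ?thesis using d by (simp add: is_decomposition_def)
    qed
  qed
  show ?thesis using ex uniq by blast
qed

end

theory Submission
  imports Defs "HOL-Computational_Algebra.Polynomial"
begin

text \<open>
  Write \<open>z = a + b\<close> with \<open>a x = q x a\<close>, \<open>b x = r x b\<close> and \<open>q \<noteq> r\<close> fifth roots of unity. The hypothesis
  \<open>0 \<notin> l(z, x)\<close> says \<open>\<Sum>\<^sub>k z\<^sup>k x z\<^sup>4\<^sup>-\<^sup>k = 0\<close>. Splitting this, and \<open>z\<^sup>5 \<in> F\<close>, into eigencomponents of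
  conjugation by \<open>x\<close> gives relations between words in \<open>a\<close> and \<open>b\<close>, and \<open>a\<^sup>5 + b\<^sup>5 = z\<^sup>5\<close>. So one of them,
  say \<open>a\<close>, is not nilpotent; then the \<open>x\<^sup>k a\<^sup>l\<close> are linearly independent, hence a basis,
  \<open>a\<^sup>5 \<in> F\<^sup>\<times>\<close>, and \<open>b = f(x) a\<^sup>m\<close> with \<open>r = q\<^sup>m\<close>. The relations become polynomial equations in the
  coefficients of \<open>f\<close>, which leave two cases. If \<open>f\<close> is a monomial, then \<open>v = a\<^sup>4 b\<close> is a Kummer
  element and \<open>x, a, v, z\<close> is a chain. Otherwise \<open>m = 3\<close>, \<open>f = e x (x - l) (x - l q)\<close> with
  \<open>l\<^sup>5 = x\<^sup>5\<close> (so \<open>A\<close> is split), and \<open>z = g a g\<^sup>-\<^sup>1\<close> for a unipotent \<open>g\<close> fixing an idempotent \<open>d\<close> of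
  \<open>F[x]\<close>; then \<open>x, 1 + (q - 1) d, g x g\<^sup>-\<^sup>1, z\<close> is a chain.
\<close>

section \<open>Fifth roots of unity and sums of nilpotents\<close>

lemma fifth_root_power_neq_1:
  fixes \<mu> :: "'f::field"
  assumes "\<mu> ^ 5 = 1" "\<mu> \<noteq> 1" "0 < d" "d < 5"
  shows "\<mu> ^ d \<noteq> 1"
proof
  assume d: "\<mu> ^ d = 1"
  have four: "\<mu> ^ 5 = \<mu> ^ 4 * \<mu>" and six: "\<mu> ^ 6 = \<mu> ^ 5 * \<mu>"
    and two: "\<mu> ^ 6 = (\<mu> ^ 2) ^ 3" and three: "\<mu> ^ 6 = (\<mu> ^ 3) ^ 2"
    by (simp_all add: power_numeral_reduce)
  consider "d = 1" | "d = 2" | "d = 3" | "d = 4" using assms by linarith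
  then show False
  proof cases
    case 1 then show False using d assms(2) by simp
  next
    case 2 then show False using d assms(1,2) six two by (simp only: power_one) simp
  next
    case 3 then show False using d assms(1,2) six three by (simp only: power_one) simp
  next
    case 4 then show False using d assms(1,2) four by (simp only: mult_1)
  qed
qed

lemma fifth_root_power_inj:
  fixes \<mu> :: "'f::field"
  assumes "\<mu> ^ 5 = 1" "\<mu> \<noteq> 1" "\<mu> ^ i = \<mu> ^ j" "i < 5" "j < 5"
  shows "i = j"
proof -
  have False if "i < j" "j < 5" "\<mu> ^ i = \<mu> ^ j" for i j
  proof -
    have "\<mu> ^ i * \<mu> ^ (j - i) = \<mu> ^ i * 1"
      using that by (subst power_add[symmetric]) simp
    moreover have "\<mu> \<noteq> 0" using assms(1) by auto
    ultimately show False using fifth_root_power_neq_1[OF assms(1,2), of "j - i"] that by simp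
  qed
  then show ?thesis using assms(3-5) by (metis nat_neq_iff)
qed

lemma sum_fifth_root:
  fixes \<mu> :: "'f::field"
  assumes "\<mu> ^ 5 = 1" "\<mu> \<noteq> 1"
  shows "1 + \<mu> + \<mu> ^ 2 + \<mu> ^ 3 + \<mu> ^ 4 = 0"
  using sum_powers_root_of_unity[OF assms] by (simp add: lessThan_nat_numeral add_ac)

text \<open>Orthogonality of the characters of Z/5. It inverts the discrete Fourier transform in
  \<open>eigencomponents_eq_0\<close>.\<close>

lemma fifth_root_orthogonality:
  fixes \<mu> :: "'f::field"
  assumes "\<mu> ^ 5 = 1" "\<mu> \<noteq> 1" "n < 5" "k < 5"
  shows "(\<Sum>j<5. (\<mu> ^ n * inverse (\<mu> ^ k)) ^ j) = (if n = k then 5 else 0)"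
proof (cases "n = k")
  case True
  have "\<mu> \<noteq> 0" using assms(1) by auto
  then show ?thesis using True by (simp del: power_mult_distrib)
next
  case False
  have m0: "\<mu> \<noteq> 0" using assms(1) by auto
  have "\<mu> ^ n \<noteq> \<mu> ^ k" using fifth_root_power_inj[OF assms(1,2) _ assms(3,4)] False by blast
  then have "\<mu> ^ n * inverse (\<mu> ^ k) \<noteq> 1" using m0 by (simp add: field_simps)
  moreover have "(\<mu> ^ n * inverse (\<mu> ^ k)) ^ 5 = (\<mu> ^ 5) ^ n * inverse ((\<mu> ^ 5) ^ k)"
    by (simp only: power_mult_distrib power_inverse power_mult[symmetric] mult.commute[of _ "5::nat"])
  then have "(\<mu> ^ n * inverse (\<mu> ^ k)) ^ 5 = 1" using assms(1) by simp
  ultimately show ?thesis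
    using False sum_powers_root_of_unity[of "\<mu> ^ n * inverse (\<mu> ^ k)" 5] by simp
qed

text \<open>Every term of the expansion contains \<open>u ^ m\<close> or \<open>v ^ n\<close>. The
  factors \<open>u + v\<close> are peeled off one at a time, so that no binomial coefficients
  occur.\<close>

lemma power_eq_0_add:
  fixes u v :: "'a::ring_1"
  assumes "u * v = v * u" "u ^ m = 0" "v ^ n = 0"
  shows "(u + v) ^ (m + n) = 0"
proof -
  have comm: "v ^ j * u = u * v ^ j" for j
    using power_commuting_commutes[of v u j] assms(1) by simp
  have "u ^ i * v ^ j * (u + v) ^ k = 0" if "m + n \<le> i + j + k" for i j k
    using that
  proof (induction k arbitrary: i j)
    case 0
    have "u ^ i = 0 \<or> v ^ j = 0"
    proof (cases "m \<le> i")
      case True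
      then have "u ^ i = u ^ m * u ^ (i - m)" by (simp flip: power_add)
      then show ?thesis using assms by simp
    next
      case False
      then have "v ^ j = v ^ n * v ^ (j - n)" using 0 by (simp flip: power_add)
      then show ?thesis using assms by simp
    qed
    then show ?case by auto
  next
    case (Suc k)
    have "u ^ i * v ^ j * (u + v) ^ Suc k
        = u ^ i * (v ^ j * u) * (u + v) ^ k + u ^ i * v ^ Suc j * (u + v) ^ k"
      by (simp only: power_Suc[of "u + v"] power_Suc2[of v] distrib_left distrib_right mult.assoc)
    also have "\<dots> = u ^ Suc i * v ^ j * (u + v) ^ k + u ^ i * v ^ Suc j * (u + v) ^ k"
      by (simp only: comm power_Suc2[of u] mult.assoc)
    also have "\<dots> = 0" using Suc.IH[of "Suc i" j] Suc.IH[of i "Suc j"] Suc.prems by simp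
    finally show ?case .
  qed
  from this[of 0 0 "m + n"] show ?thesis by simp
qed

section \<open>Semicommuting elements and eigencomponents\<close>

context assoc_algebra
begin

lemma scale_mult_scale: "scale c a * scale d b = scale (c * d) (a * b)"
  by (simp add: scale_mult_left scale_mult_right)

lemma power_scale: "scale c a ^ n = scale (c ^ n) (a ^ n)"
  by (induction n) (simp_all add: scale_mult_scale)

lemma power_semicommute:
  assumes "w * u = scale \<mu> (u * w)"
  shows "w ^ n * u = scale (\<mu> ^ n) (u * w ^ n)" "w * u ^ n = scale (\<mu> ^ n) (u ^ n * w)"
proof -
  show "w ^ n * u = scale (\<mu> ^ n) (u * w ^ n)"
  proof (induction n)
    case (Suc n)
    have "w ^ Suc n * u = w * (w ^ n * u)" by (simp add: mult.assoc)
    also have "\<dots> = scale (\<mu> ^ n) (w * u * w ^ n)"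
      by (simp add: Suc scale_mult_right mult.assoc)
    also have "\<dots> = scale (\<mu> ^ Suc n) (u * w ^ Suc n)"
      by (simp add: assms scale_mult_left mult.assoc mult.commute)
    finally show ?case .
  qed simp
  show "w * u ^ n = scale (\<mu> ^ n) (u ^ n * w)"
  proof (induction n)
    case (Suc n)
    have "w * u ^ Suc n = w * u * u ^ n" by (simp add: mult.assoc)
    also have "\<dots> = scale \<mu> (u * (w * u ^ n))"
      by (simp add: assms scale_mult_left mult.assoc)
    also have "\<dots> = scale (\<mu> ^ Suc n) (u ^ Suc n * w)"
      by (simp add: Suc scale_mult_right mult.assoc)
    finally show ?case .
  qed simp
qed

text \<open>The factor \<open>u\<^sup>4\<close> remains because \<open>u\<close> need not be cancellable.\<close>

lemma eigencomponents_eq_0: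
  fixes w :: "nat \<Rightarrow> 'a"
  assumes mu: "\<mu> ^ 5 = 1" "\<mu> \<noteq> 1" and five: "(5::'f) \<noteq> 0" and kappa: "\<kappa> \<noteq> 0"
    and sum: "(\<Sum>n<5. w n) = 0"
    and eig: "\<And>n. n < 5 \<Longrightarrow> w n * u = scale (\<kappa> * \<mu> ^ n) (u * w n)"
    and k: "k < 5"
  shows "u ^ 4 * w k = 0"
proof -
  \<comment> \<open>Moving a factor \<open>u\<close> from the right of the vanishing sum to its left
    multiplies the n-th term by \<open>\<kappa> * \<mu> ^ n\<close>. After division by
    \<open>\<kappa>\<close> this is the next weighted sum, with one more \<open>u\<close> in
    front.\<close>
  have S: "u ^ j * (\<Sum>n<5. scale ((\<mu> ^ n) ^ j) (w n)) = 0" for j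
  proof (induction j)
    case (Suc j)
    have "0 = u ^ j * (\<Sum>n<5. scale ((\<mu> ^ n) ^ j) (w n)) * u" by (simp add: Suc)
    also have "\<dots> = u ^ j * (\<Sum>n<5. scale ((\<mu> ^ n) ^ j) (w n * u))"
      by (simp add: mult.assoc sum_distrib_right scale_mult_left)
    also have "(\<Sum>n<5. scale ((\<mu> ^ n) ^ j) (w n * u))
        = scale \<kappa> (u * (\<Sum>n<5. scale ((\<mu> ^ n) ^ Suc j) (w n)))"
      by (simp add: eig sum_distrib_left scale_sum_right scale_mult_right mult.commute mult.assoc
          mult.left_commute)
    finally have "scale \<kappa> (u ^ Suc j * (\<Sum>n<5. scale ((\<mu> ^ n) ^ Suc j) (w n))) = 0"
      by (simp only: scale_mult_right mult.assoc[symmetric] power_Suc2)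
    then show ?case using kappa by simp
  qed (simp add: sum)
  have S4: "u ^ 4 * (\<Sum>n<5. scale ((\<mu> ^ n) ^ j) (w n)) = 0" if "j < 5" for j
  proof -
    have "u ^ 4 = u ^ (4 - j) * u ^ j" using that by (simp flip: power_add)
    then show ?thesis using S[of j] by (simp add: mult.assoc)
  qed
  \<comment> \<open>Fourier inversion over j isolates the k-th term.\<close>
  have "0 = (\<Sum>j<5. scale (inverse (\<mu> ^ k) ^ j) (u ^ 4 * (\<Sum>n<5. scale ((\<mu> ^ n) ^ j) (w n))))"
    by (simp add: S4)
  also have "\<dots> = (\<Sum>j<5. \<Sum>n<5. scale ((\<mu> ^ n * inverse (\<mu> ^ k)) ^ j) (u ^ 4 * w n))"
    by (simp add: sum_distrib_left scale_mult_right scale_sum_right power_mult_distrib mult.commute)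
  also have "\<dots> = (\<Sum>n<5. scale (\<Sum>j<5. (\<mu> ^ n * inverse (\<mu> ^ k)) ^ j) (u ^ 4 * w n))"
    by (subst sum.swap) (simp add: scale_sum_left)
  also have "\<dots> = (\<Sum>n<5. if n = k then scale 5 (u ^ 4 * w n) else 0)"
    by (intro sum.cong refl) (simp add: fifth_root_orthogonality[OF mu _ k])
  also have "\<dots> = scale 5 (u ^ 4 * w k)" using k by simp
  finally show ?thesis using five by simp
qed

end

section \<open>The basis \<open>x\<^sup>k a\<^sup>l\<close>\<close>

text \<open>Cyclicity of the algebra enters only through the bound 25 on its dimension.\<close>

locale kummer_pair = assoc_algebra scale
  for scale :: "'f::field \<Rightarrow> 'a::ring_1 \<Rightarrow> 'a" +
  fixes q \<xi> :: 'f and x a :: 'a and S :: "'a set"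
  assumes five_neq_0: "(5::'f) \<noteq> 0"
    and q5: "q ^ 5 = 1" and q_neq_1: "q \<noteq> 1"
    and xi_neq_0: "\<xi> \<noteq> 0" and x5: "x ^ 5 = scale \<xi> 1"
    and ax: "a * x = scale q (x * a)"
    and not_nilpotent: "\<And>n. a ^ n \<noteq> 0"
    and finite_S: "finite S" and card_S: "card S \<le> 25" and span_S: "span S = UNIV"
begin

lemma q_neq_0: "q \<noteq> 0"
  using q5 by auto

lemma x_power_cancel: "x ^ n * w = 0 \<longleftrightarrow> w = 0"
proof (induction n arbitrary: w)
  case (Suc n)
  have "w = 0" if "x * w = 0" for w
  proof -
    have "scale \<xi> w = x ^ 4 * (x * w)"
      using x5 scale_mult_left[of \<xi> 1 w]
      by (simp flip: mult.assoc power_Suc2 add: mult.assoc[symmetric])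
    then show ?thesis using that xi_neq_0 by simp
  qed
  then show ?case using Suc by (auto simp: mult.assoc power_Suc2 simp del: power_Suc)
qed simp

text \<open>Horner scheme for the substitution homomorphism F[X] -> F[x]: coefficients in the field,
  values in the noncommutative algebra.\<close>

definition ev :: "'f poly \<Rightarrow> 'a" where
  "ev p = fold_coeffs (\<lambda>c w. scale c 1 + x * w) p 0"

lemma ev_0 [simp]: "ev 0 = 0"
  by (simp add: ev_def)

lemma ev_pCons [simp]: "ev (pCons c p) = scale c 1 + x * ev p"
  by (cases "p = 0 \<and> c = 0") (auto simp: ev_def)

lemma ev_add: "ev (p + r) = ev p + ev r"
  by (induction p r rule: poly_induct2) (simp_all add: algebra_simps scale_left_distrib)

lemma ev_diff: "ev (p - r) = ev p - ev r"
  using ev_add[of "p - r" r] by simp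

lemma ev_sum: "ev (sum f A) = (\<Sum>i\<in>A. ev (f i))"
  by (induction A rule: infinite_finite_induct) (simp_all add: ev_add)

lemma ev_smult: "ev (smult c p) = scale c (ev p)"
  by (induction p) (simp_all add: scale_right_distrib scale_mult_right)

lemma ev_monom: "ev (monom c n) = scale c (x ^ n)"
  by (induction n) (simp_all add: monom_0 monom_Suc scale_mult_right)

lemma ev_mult: "ev (p * r) = ev p * ev r"
  by (induction p)
    (simp_all add: ev_add ev_smult distrib_right scale_mult_left mult.assoc)

lemma ev_commute: "ev p * ev r = ev r * ev p"
  by (simp flip: ev_mult add: mult.commute)

text \<open>Conjugation by \<open>a ^ n\<close> acts on F[x] as the dilation that sends x to q^n
  x.\<close>

lemma a_power_ev: "a ^ n * ev p = ev (pcompose p [:0, q ^ n:]) * a ^ n"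
proof (induction p)
  case (pCons c p)
  have "a ^ n * ev (pCons c p) = scale c (a ^ n) + a ^ n * x * ev p"
    by (simp add: distrib_left scale_mult_right mult.assoc)
  also have "\<dots> = scale c (a ^ n) + scale (q ^ n) (x * (a ^ n * ev p))"
    by (simp add: power_semicommute[OF ax] scale_mult_left mult.assoc)
  also have "\<dots> = ev (pcompose (pCons c p) [:0, q ^ n:]) * a ^ n"
    by (simp add: pCons pcompose_pCons ev_add ev_mult ev_smult distrib_right scale_mult_left
        scale_mult_right mult.assoc)
  finally show ?case .
qed simp

text \<open>Under conjugation by \<open>a\<close> the eigenvalue of a monomial depends on the
  exponent of \<open>x\<close> alone, so it separates the coefficients of a polynomial in
  \<open>x\<close>.\<close>

lemma ev_times_a: "x ^ k * a ^ n * a = scale (inverse q ^ k) (a * (x ^ k * a ^ n))"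
  using q_neq_0 by (simp add: power_semicommute[OF ax] scale_mult_left power_commutes mult.assoc
      power_inverse flip: mult.assoc[of a])

text \<open>The terms of the polynomial have distinct eigenvalues under \<open>a\<close>, so each
  vanishes after multiplication by \<open>a ^ 4\<close>. That factor is moved into the power of
  \<open>a\<close> on the right, which is nonzero because \<open>a\<close> is not nilpotent;
  invertibility of \<open>a\<close> is not yet known.\<close>

lemma ev_eq_0_iff:
  assumes "ev p * a ^ n = 0" "degree p < 5"
  shows "p = 0"
proof -
  define v where "v k = scale (coeff p k) (x ^ k * a ^ n)" for k
  have "ev p = (\<Sum>k<5. scale (coeff p k) (x ^ k))"
    using assms(2) poly_as_sum_of_monoms'[of p 4]
    by (simp flip: ev_monom ev_sum add: lessThan_Suc_atMost[symmetric] eval_nat_numeral)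
  then have "(\<Sum>k<5. v k) = 0"
    using assms(1) by (simp add: v_def sum_distrib_right scale_mult_left)
  then have v: "a ^ 4 * v k = 0" if "k < 5" for k
    using that five_neq_0 q5 q_neq_1
    by (intro eigencomponents_eq_0[where \<kappa> = 1 and \<mu> = "inverse q"])
      (simp_all add: v_def scale_mult_left scale_mult_right ev_times_a power_inverse mult.commute)
  have "coeff p k = 0" for k
  proof (cases "k < 5")
    case True
    have "a ^ 4 * v k = scale (coeff p k * (q ^ 4) ^ k) (x ^ k * a ^ (4 + n))"
      using power_semicommute(2)[OF power_semicommute(1)[OF ax], of 4 k]
      by (simp add: v_def scale_mult_right power_add scale_mult_left flip: mult.assoc)
    then show ?thesis using v[OF True] not_nilpotent q_neq_0 by (simp add: x_power_cancel)
  next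
    case False
    then show ?thesis using assms(2) by (simp add: coeff_eq_0)
  qed
  then show ?thesis by (simp add: poly_eq_iff)
qed

lemma ev_x_commute: "ev p * x = x * ev p"
  using ev_commute[of p "[:0, 1:]"] by simp

text \<open>The summands have the distinct eigenvalues \<open>q ^ l\<close> under \<open>x\<close>,
  and \<open>x\<close> can be cancelled.\<close>

lemma ev_sum_eq_0:
  assumes "(\<Sum>l<5. ev (p l) * a ^ l) = 0" and l: "l < 5" and "degree (p l) < 5"
  shows "p l = 0"
proof -
  have "x ^ 4 * (ev (p l) * a ^ l) = 0"
  proof (rule eigencomponents_eq_0[where \<kappa> = 1 and \<mu> = q, OF q5 q_neq_1 five_neq_0 _ assms(1)])
    fix n
    show "ev (p n) * a ^ n * x = scale (1 * q ^ n) (x * (ev (p n) * a ^ n))"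
      by (simp add: power_semicommute[OF ax] scale_mult_right mult.assoc)
        (simp add: ev_x_commute flip: mult.assoc)
  qed (use l in simp_all)
  then show ?thesis using assms(3) by (auto simp: x_power_cancel intro: ev_eq_0_iff)
qed

lemma basis_coeffs_eq_0:
  assumes "(\<Sum>(k, l)\<in>{..<5} \<times> {..<5}. scale (c k l) (x ^ k * a ^ l)) = 0" "k < 5" "l < 5"
  shows "c k l = 0"
proof -
  define p where "p l = (\<Sum>k<5. monom (c k l) k)" for l
  have deg: "degree (p l) < 5" for l
    unfolding p_def by (intro degree_sum_less) (auto intro: le_less_trans[OF degree_monom_le])
  have "(\<Sum>l<5. ev (p l) * a ^ l) = (\<Sum>l<5. \<Sum>k<5. scale (c k l) (x ^ k * a ^ l))"
    by (simp add: p_def ev_sum ev_monom sum_distrib_right scale_mult_left)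
  also have "\<dots> = 0"
    using assms(1) by (subst sum.swap) (simp add: sum.cartesian_product)
  finally have "p l = 0" using ev_sum_eq_0 deg assms(3) by blast
  then have "coeff (p l) k = 0" by simp
  then show ?thesis using assms(2) by (simp add: p_def coeff_sum coeff_monom)
qed

text \<open>The 25 monomials are independent and the dimension is at most 25; one more independent
  vector would exceed it.\<close>

lemma expansion:
  obtains p where "\<And>l. degree (p l) < 5" "w = (\<Sum>l<5. ev (p l) * a ^ l)"
proof -
  define I where "I = {..<5::nat} \<times> {..<5::nat}"
  define b where "b = (\<lambda>(k, l). x ^ k * a ^ l)"
  have coeffs: "c i = 0" if "(\<Sum>i\<in>I. scale (c i) (b i)) = 0" "i \<in> I" for c i
    using basis_coeffs_eq_0[of "\<lambda>k l. c (k, l)"] that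
    by (auto simp: I_def b_def case_prod_unfold)
  have fin: "finite I" by (simp add: I_def)
  have inj: "inj_on b I"
  proof (rule inj_onI, rule ccontr)
    fix i j assume ij: "i \<in> I" "j \<in> I" "b i = b j" "i \<noteq> j"
    define c where "c k = (if k = i then 1 else if k = j then - 1 else (0::'f))" for k
    have "(\<Sum>k\<in>I. scale (c k) (b k))
        = (\<Sum>k\<in>I. (if k = i then b k else 0) - (if k = j then b k else 0))"
      using ij by (intro sum.cong) (auto simp: c_def)
    also have "\<dots> = 0" using ij fin by (simp add: sum_subtractf)
    finally show False using coeffs[of c i] ij by (simp add: c_def)
  qed
  have indep: "independent (b ` I)"
  proof (rule independent_if_scalars_zero)
    fix f v assume "(\<Sum>v\<in>b ` I. scale (f v) v) = 0" "v \<in> b ` I"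
    then show "f v = 0" using coeffs[of "f \<circ> b"] inj by (auto simp: sum.reindex)
  qed (simp add: fin)
  have "w \<in> span (b ` I)"
  proof (rule ccontr)
    assume w: "w \<notin> span (b ` I)"
    then have "independent (insert w (b ` I))" using indep by (rule independent_insertI)
    then have "card (insert w (b ` I)) \<le> card S"
      using independent_span_bound[OF finite_S] span_S by blast
    moreover have "w \<notin> b ` I" using w span_base by blast
    then have "card (insert w (b ` I)) = 26"
      using fin by (simp add: card_image[OF inj]) (simp add: I_def)
    ultimately show False using card_S by simp
  qed
  then obtain c where c: "w = (\<Sum>v\<in>b ` I. scale (c v) v)"
    unfolding span_finite[OF finite_imageI[OF fin]] by blast
  define p where "p l = (\<Sum>k<5. monom (c (b (k, l))) k)" for l
  have "w = (\<Sum>(k, l)\<in>I. scale (c (b (k, l))) (x ^ k * a ^ l))"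
    unfolding c by (subst sum.reindex[OF inj]) (simp add: b_def case_prod_unfold)
  also have "\<dots> = (\<Sum>l<5. \<Sum>k<5. scale (c (b (k, l))) (x ^ k * a ^ l))"
    unfolding I_def sum.cartesian_product[symmetric] by (rule sum.swap)
  also have "\<dots> = (\<Sum>l<5. ev (p l) * a ^ l)"
    by (simp add: p_def ev_sum ev_monom sum_distrib_right scale_mult_left)
  finally have "w = (\<Sum>l<5. ev (p l) * a ^ l)" .
  moreover have "degree (p l) < 5" for l
    unfolding p_def by (intro degree_sum_less) (auto intro: le_less_trans[OF degree_monom_le])
  ultimately show thesis using that by blast
qed

lemma eigenvector_expansion:
  assumes "w * x = scale (q ^ m) (x * w)" "m < 5"
  obtains p where "degree p < 5" "w = ev p * a ^ m"
proof -
  obtain p where p: "\<And>l. degree (p l) < 5" "w = (\<Sum>l<5. ev (p l) * a ^ l)"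
    using expansion[of w] by blast
  \<comment> \<open>Subtracting \<open>w\<close> from the summand of its own eigenvalue turns the
    expansion into a vanishing sum of eigenvectors.\<close>
  define v where "v l = ev (p l) * a ^ l - (if l = m then w else 0)" for l
  have "x ^ 4 * v m = 0"
  proof (rule eigencomponents_eq_0[where \<kappa> = 1 and \<mu> = q, OF q5 q_neq_1 five_neq_0])
    show "(\<Sum>l<5. v l) = 0" using p assms(2) by (simp add: v_def sum_subtractf)
    have "ev (p l) * a ^ l * x = scale (q ^ l) (x * (ev (p l) * a ^ l))" for l
      by (simp add: power_semicommute[OF ax] scale_mult_right mult.assoc)
        (simp add: ev_x_commute flip: mult.assoc)
    then show "v l * x = scale (1 * q ^ l) (x * v l)" for l
      by (simp add: v_def assms(1) left_diff_distrib right_diff_distrib scale_right_diff_distrib)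
  qed (use assms in simp_all)
  then show thesis using that[of "p m"] p(1) by (simp add: v_def x_power_cancel)
qed

text \<open>Commuting with \<open>x\<close> makes the element a polynomial in \<open>x\<close>.
  Commuting with \<open>a\<close> makes this polynomial invariant under X -> q X, which leaves only
  the constant term.\<close>

lemma centralizer:
  assumes "w * x = x * w" "w * a = a * w"
  obtains c where "w = scale c 1"
proof -
  obtain p where p: "degree p < 5" "w = ev p"
    using eigenvector_expansion[of w 0] assms(1) by auto
  have "a * ev p = ev (pcompose p [:0, q:]) * a" using a_power_ev[of 1 p] by simp
  then have "ev (pcompose p [:0, q:] - p) * a ^ 1 = 0"
    using assms(2) unfolding p(2) ev_diff left_diff_distrib power_one_right by simp
  moreover have "degree (pcompose p [:0, q:] - p) < 5"
    using p(1) by (intro degree_diff_less) (simp_all add: degree_pcompose q_neq_0)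
  ultimately have eq: "pcompose p [:0, q:] = p" using ev_eq_0_iff by fastforce
  have "coeff p k = 0" if "k \<noteq> 0" for k
  proof (cases "k < 5")
    case True
    have "coeff (pcompose p [:0, q:]) k = q ^ k * coeff p k"
      by (simp add: coeff_pcompose_linear)
    then show ?thesis
      using eq fifth_root_power_neq_1[OF q5 q_neq_1 _ True] that
      by (metis mult_cancel_right1 bot_nat_0.not_eq_extremum)
  next
    case False
    then show ?thesis using p(1) by (simp add: coeff_eq_0)
  qed
  then have "p = [:coeff p 0:]" by (intro poly_eqI) (auto simp: coeff_pCons split: nat.splits)
  then have "ev p = ev [:coeff p 0:]" by (rule arg_cong)
  then show thesis using that[of "coeff p 0"] p(2) by simp
qed

text \<open>As \<open>q ^ 5 = 1\<close>, the power \<open>a ^ 5\<close> commutes with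
  \<open>x\<close> and \<open>a\<close>, hence is a scalar. This makes \<open>a\<close>
  invertible.\<close>

lemma a5: obtains \<alpha> where "\<alpha> \<noteq> 0" "a ^ 5 = scale \<alpha> 1"
proof -
  have "a ^ 5 * x = x * a ^ 5" using power_semicommute(1)[OF ax, of 5] q5 by simp
  moreover have "a ^ 5 * a = a * a ^ 5" by (simp add: power_commutes)
  ultimately obtain \<alpha> where "a ^ 5 = scale \<alpha> 1" using centralizer by blast
  then show thesis using that not_nilpotent[of 5] by force
qed

end

section \<open>Chains of weight one\<close>

text \<open>This amounts to weight 1, since every fifth root of unity is a power of \<open>\<rho>\<close>.\<close>

definition (in assoc_algebra) linked :: "'a \<Rightarrow> 'a \<Rightarrow> bool" where
  "linked u v \<longleftrightarrow> u \<in> kummer_elements scale 5 \<and> v \<in> kummer_elements scale 5 \<and>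
     (\<exists>\<mu>. \<mu> ^ 5 = 1 \<and> v * u = scale \<mu> (u * v))"

lemma (in assoc_algebra) linked_sym: "linked u v \<Longrightarrow> linked v u"
proof -
  assume l: "linked u v"
  then obtain \<mu> where mu: "\<mu> ^ 5 = 1" "v * u = scale \<mu> (u * v)" by (auto simp: linked_def)
  have "\<mu> \<noteq> 0" using mu(1) by auto
  then have "u * v = scale (inverse \<mu>) (v * u)" using mu(2) by simp
  moreover have "inverse \<mu> ^ 5 = 1" using mu(1) by (simp add: power_inverse)
  ultimately show "linked v u" using l unfolding linked_def by blast
qed

lemma fifth_root_power: "(\<mu> ^ n) ^ 5 = 1" if "\<mu> ^ 5 = 1" for \<mu> :: "'f::field"
  using that by (metis mult.commute power_mult power_one)

context kummer_pair
begin

lemma a_cancel: "a * w = 0 \<Longrightarrow> w = 0"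
proof -
  assume w: "a * w = 0"
  obtain \<alpha> where al: "\<alpha> \<noteq> 0" "a ^ 5 = scale \<alpha> 1" by (rule a5)
  have "scale \<alpha> w = a ^ 5 * w" by (simp add: al scale_mult_left)
  also have "\<dots> = a ^ 4 * (a * w)" by (simp add: mult.assoc[symmetric] flip: power_Suc2)
  finally show "w = 0" using w al by simp
qed

lemma a_power_cancel: "a ^ n * w = 0 \<Longrightarrow> w = 0"
  by (induction n) (auto simp: mult.assoc dest: a_cancel)

lemma x_not_scalar: "x \<noteq> scale c 1"
proof
  assume x: "x = scale c 1"
  have "x \<noteq> 0" using x_power_cancel[of 1 1] by auto
  then have "c \<noteq> 0" using x by auto
  moreover have "scale c a = scale (c * q) a"
    using ax unfolding x by (simp add: scale_mult_left scale_mult_right mult.commute)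
  then have "c = c * q \<or> a = 0" by (simp only: scale_right_imp_eq scale_cancel_right)
  ultimately show False using q_neq_1 not_nilpotent[of 1] by simp
qed

lemma x_kummer: "x \<in> kummer_elements scale 5"
  using x_not_scalar x5 xi_neq_0 by (auto simp: kummer_elements_def)

text \<open>\<open>u ^ 5\<close> commutes with \<open>x\<close> and \<open>a\<close>, so it is a
  scalar, nonzero by cancellation. A scalar \<open>u\<close> would commute with both, against
  \<open>nu\<close>.\<close>

lemma kummerI:
  assumes cancel: "\<And>w. u * w = 0 \<Longrightarrow> w = 0"
    and ux: "u * x = scale \<mu> (x * u)" "\<mu> ^ 5 = 1" and ua: "u * a = scale \<nu> (a * u)" "\<nu> ^ 5 = 1"
    and nu: "\<nu> \<noteq> 1 \<or> \<mu> \<noteq> 1"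
  shows "u \<in> kummer_elements scale 5"
proof -
  have "u ^ 5 * x = x * u ^ 5" "u ^ 5 * a = a * u ^ 5"
    using power_semicommute(1)[OF ux(1), of 5] power_semicommute(1)[OF ua(1), of 5]
    by (simp_all add: ux(2) ua(2))
  then obtain c where c: "u ^ 5 = scale c 1" by (rule centralizer)
  have "u ^ n * w = 0 \<Longrightarrow> w = 0" for n w
    by (induction n) (auto simp: mult.assoc dest: cancel)
  from this[of 5 1] have "c \<noteq> 0" using c by auto
  moreover have "u \<noteq> scale d 1" for d
  proof
    assume u: "u = scale d 1"
    have "d \<noteq> 0" using cancel[of 1] u by auto
    moreover have "scale d x = scale (d * \<mu>) x" "scale d a = scale (d * \<nu>) a"
      using ux(1) ua(1) unfolding u by (simp_all add: scale_mult_left scale_mult_right mult.commute)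
    then have "(d = d * \<mu> \<or> x = 0) \<and> (d = d * \<nu> \<or> a = 0)" by (simp only: scale_cancel_right)
    ultimately show False
      using nu not_nilpotent[of 1] x_power_cancel[of 1 1] by auto
  qed
  ultimately show ?thesis using c by (auto simp: kummer_elements_def)
qed

lemma linked_x_a: "linked x a"
proof -
  have "a \<in> kummer_elements scale 5"
    by (rule kummerI[of a q 1]) (simp_all add: a_cancel ax q5 q_neq_1)
  then show ?thesis unfolding linked_def using x_kummer ax q5 by blast
qed

text \<open>The chain is x, a, v, z, where v = a^4 b is a scalar multiple of a^-1 b. Since b is a
  monomial, v semicommutes with \<open>x\<close> and \<open>a\<close>; the bounds on
  \<open>s\<close> make its eigenvalue under \<open>a\<close> different from 1.\<close>

lemma linked_monomial:
  assumes g: "\<gamma> \<noteq> 0" and s: "0 < s" "s < 5"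
    and z: "a + scale \<gamma> (x ^ s * a ^ m) \<in> kummer_elements scale 5"
  shows "linked\<^sup>+\<^sup>+ x (a + scale \<gamma> (x ^ s * a ^ m))"
proof -
  obtain \<alpha> where al: "\<alpha> \<noteq> 0" "a ^ 5 = scale \<alpha> 1" by (rule a5)
  define b where "b = scale \<gamma> (x ^ s * a ^ m)"
  define \<nu> where "\<nu> = inverse q ^ s"
  define v where "v = a ^ 4 * b"
  have "a ^ 4 * x ^ s = scale ((q ^ 4) ^ s) (x ^ s * a ^ 4)"
    using power_semicommute(2)[OF power_semicommute(1)[OF ax]] .
  then have v: "v = scale (\<gamma> * (q ^ 4) ^ s) (x ^ s * a ^ (4 + m))"
    by (simp add: v_def b_def scale_mult_left scale_mult_right power_add flip: mult.assoc)
  have va: "v * a = scale \<nu> (a * v)"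
    unfolding v \<nu>_def by (simp add: scale_mult_left scale_mult_right ev_times_a mult.commute)
  have "x ^ s * a ^ (4 + m) * x = scale (q ^ (4 + m)) (x * (x ^ s * a ^ (4 + m)))"
    by (simp only: mult.assoc power_semicommute(1)[OF ax] scale_mult_right)
      (simp only: power_commutes mult.assoc[symmetric])
  then have vx: "v * x = scale (q ^ (4 + m)) (x * v)"
    unfolding v by (simp only: scale_mult_left scale_mult_right scale_scale mult.commute)
  have nu5: "\<nu> ^ 5 = 1"
    unfolding \<nu>_def using q5 by (intro fifth_root_power) (simp add: power_inverse)
  have "\<nu> \<noteq> 1"
    using fifth_root_power_neq_1[OF q5 q_neq_1 s] by (simp add: \<nu>_def power_inverse)
  moreover have "w = 0" if "v * w = 0" for w
    using that g q_neq_0 by (auto simp: v scale_mult_left mult.assoc x_power_cancel dest: a_power_cancel)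
  ultimately have vK: "v \<in> kummer_elements scale 5"
    using kummerI[OF _ vx fifth_root_power[OF q5] va nu5] by blast
  \<comment> \<open>In this form z is \<open>a\<close> times a polynomial in \<open>v\<close>, so
    \<open>v\<close> passes \<open>z\<close> with the same root of unity as it passes
    \<open>a\<close>.\<close>
  have zv: "a + b = a + scale (inverse \<alpha>) (a * v)"
    using al by (simp add: v_def scale_mult_left flip: mult.assoc power_Suc)
  have "v * (a * v) = scale \<nu> (a * v * v)"
    using va by (simp flip: mult.assoc add: scale_mult_left)
  then have "(a + b) * v = a * v + scale (inverse \<alpha>) (a * v * v)"
    "v * (a + b) = scale \<nu> (a * v + scale (inverse \<alpha>) (a * v * v))"
    unfolding zv by (simp_all only: distrib_left distrib_right scale_mult_left scale_mult_right
        scale_right_distrib va scale_scale mult.commute)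
  then have "v * (a + b) = scale \<nu> ((a + b) * v)" by simp
  then have "linked (a + b) v"
    unfolding linked_def using vK z nu5 b_def by blast
  moreover have "linked a v"
    unfolding linked_def using va vK nu5 linked_x_a linked_def by blast
  ultimately have "linked x a" "linked a v" "linked v (a + b)"
    using linked_x_a linked_sym by blast+
  then show ?thesis unfolding b_def by (blast intro: tranclp.r_into_trancl tranclp.trancl_into_trancl)
qed

end

section \<open>Conjugation by a unipotent element\<close>

lemma conjugate_power:
  fixes g g' x :: "'a::monoid_mult"
  assumes "g' * g = 1" "g * g' = 1"
  shows "(g * x * g') ^ n = g * x ^ n * g'"
proof (induction n)
  case (Suc n)
  have "(g * x * g') ^ Suc n = g * x * (g' * g) * x ^ n * g'"
    by (simp only: power_Suc Suc) (simp only: mult.assoc)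
  then show ?case using assms by (simp add: mult.assoc)
qed (simp add: assms)

context kummer_pair
begin

lemma ev_eigenvector: "x * w = scale l w \<Longrightarrow> ev p * w = scale (poly p l) w"
  by (induction p)
    (simp_all add: distrib_right scale_mult_left mult.assoc scale_mult_right scale_left_distrib
      mult.commute)

text \<open>Reduction modulo X^5 - \<xi>.\<close>

lemma ev_reduce:
  "ev [:c0, c1, c2, c3, c4, c5, c6, c7, c8, c9:]
     = ev [:c0 + \<xi> * c5, c1 + \<xi> * c6, c2 + \<xi> * c7, c3 + \<xi> * c8, c4 + \<xi> * c9:]"
proof -
  have "ev (r + monom 1 5 * p) = ev (r + smult \<xi> p)" for r p
    by (simp add: ev_add ev_mult ev_monom ev_smult x5 scale_mult_left)
  from this[of "[:c0, c1, c2, c3, c4:]" "[:c5, c6, c7, c8, c9:]"] show ?thesis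
    by (simp add: monom_altdef eval_nat_numeral)
qed

text \<open>With \<open>b = N * a - a * N\<close>, \<open>N * N = 0\<close> and
  \<open>b * N = 0\<close>, the element g = 1 + N conjugates \<open>a\<close> to
  \<open>a + b\<close>. Hence z is related to y = g x g^-1 as \<open>a\<close> is to
  \<open>x\<close>, and an element k commuting with both \<open>x\<close> and y joins them.\<close>

lemma linked_conjugate:
  assumes l: "l ^ 5 = \<xi>" and e: "e \<noteq> 0"
    and b: "b = ev [:0, e * l ^ 2 * q, - (e * l * (1 + q)), e:] * a ^ 3"
    and z: "a + b \<in> kummer_elements scale 5"
  shows "linked\<^sup>+\<^sup>+ x (a + b)"
proof -
  note phi = sum_fifth_root[OF q5 q_neq_1]
  have l0: "l \<noteq> 0" using l xi_neq_0 by auto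
  have q3: "q ^ 3 \<noteq> 1" using fifth_root_power_neq_1[OF q5 q_neq_1, of 3] by simp
  \<comment> \<open>Chosen so that n(X) - n(q X), whose leading coefficient is \<kappa> (1 - q^3),
    has the leading coefficient \<open>e\<close> of f.\<close>
  define \<kappa> where "\<kappa> = e / (1 - q ^ 3)"
  have e_def: "e = \<kappa> * (1 - q ^ 3)" using q3 by (simp add: \<kappa>_def)
  txt \<open>\<open>n = \<kappa> (X - l) (X - l q) (X - l q\<^sup>2)\<close> solves \<open>n(X) - n(q X) = f(X)\<close>; with \<open>N = n(x) a\<^sup>2\<close> this
    reads \<open>b = N a - a N\<close>.\<close>
  define n where
    "n = [:- (\<kappa> * l ^ 3 * q ^ 3), \<kappa> * l ^ 2 * (q + q ^ 2 + q ^ 3), - (\<kappa> * l * (1 + q + q ^ 2)), \<kappa>:]"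
  define N where "N = ev n * a ^ 2"
  define f where "f = [:0, e * l ^ 2 * q, - (e * l * (1 + q)), e:]"
  have "n - pcompose n [:0, q:] = f"
    unfolding n_def f_def e_def
    by (simp add: pcompose_pCons power2_eq_square power3_eq_cube algebra_simps)
  then have "b = ev (n - pcompose n [:0, q:]) * a ^ 3" unfolding b f_def by simp
  also have "\<dots> = N * a - a * N"
    using a_power_ev[of 1 n]
    by (simp add: N_def ev_diff left_diff_distrib power2_eq_square power3_eq_cube
        flip: mult.assoc)
  finally have b_eq: "b = N * a - a * N" .
  have root: "ev ([:- \<xi>, 0, 0, 0, 0, 1:] * p) = 0" for p
  proof -
    have "ev [:- \<xi>, 0, 0, 0, 0, 1:] = 0" using x5 by (simp add: eval_nat_numeral)
    then show ?thesis by (simp only: ev_mult mult_zero_left)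
  qed
  \<comment> \<open>The roots of n are l, l q, l q^2 and those of n(q^2 X) are l q^3, l q^4, l.
    Together they exhaust the fifth roots of \<xi>, and the cofactor is a multiple of X - l.\<close>
  have "n * pcompose n [:0, q ^ 2:] = [:- \<xi>, 0, 0, 0, 0, 1:] * [:- (\<kappa> ^ 2 * q * l), \<kappa> ^ 2 * q:]"
    unfolding n_def l[symmetric]
    by (simp add: pcompose_pCons) 
      (intro conjI disjI2; (use phi in algebra | simp add: eval_nat_numeral))
  then have "ev n * ev (pcompose n [:0, q ^ 2:]) = 0"
    using root by (simp only: ev_mult[symmetric])
  then have NN: "N * N = 0"
    unfolding N_def mult.assoc[of "ev n"] mult.assoc[symmetric, of "a ^ 2"] a_power_ev
    by (simp flip: mult.assoc)
  \<comment> \<open>The roots 0, l, l q of f and l q^2, l q^3, l q^4 of n(q^3 X) are all fifth roots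
    of \<xi> and 0, so the cofactor is a multiple of X.\<close>
  have "f * pcompose n [:0, q ^ 3:] = [:- \<xi>, 0, 0, 0, 0, 1:] * [:0, e * \<kappa> * q ^ 4:]"
    unfolding n_def l[symmetric] f_def
    by (simp add: pcompose_pCons) 
      (intro conjI disjI2; (use phi in algebra | simp add: eval_nat_numeral))
  then have "ev f * ev (pcompose n [:0, q ^ 3:]) = 0"
    using root by (simp only: ev_mult[symmetric])
  then have bN: "b * N = 0"
    unfolding b f_def[symmetric] N_def mult.assoc[of "ev f"] mult.assoc[symmetric, of "a ^ 3"] a_power_ev
    by (simp flip: mult.assoc)

  txt \<open>\<open>d\<close> is the idempotent of \<open>F[x]\<close> for the eigenvalue \<open>l q\<^sup>2\<close> of \<open>x\<close>, the one that \<open>N\<close> neither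
    leaves nor reaches.\<close>
  define \<mu> where "\<mu> = l * q ^ 2"
  have mu0: "\<mu> \<noteq> 0" using l0 q_neq_0 by (simp add: \<mu>_def)
  have "\<mu> ^ 5 = l ^ 5 * (q ^ 5) ^ 2" unfolding \<mu>_def by (simp add: power_mult_distrib)
  then have mu5: "\<mu> ^ 5 = \<xi>" using q5 l by simp
  \<comment> \<open>\<open>h\<close> is the quotient of X^5 - \<xi> by X - \<mu>. As h(\<mu>) = 5
    \<mu>^4, the factor \<open>c\<close> normalises its value at \<mu> to 1, which makes
    \<open>d\<close> idempotent.\<close>
  define h where "h = [:\<mu> ^ 4, \<mu> ^ 3, \<mu> ^ 2, \<mu>, 1:]"
  define c where "c = inverse (5 * \<mu> ^ 4)"
  define d where "d = ev (smult c h)"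
  have "[:- \<mu>, 1:] * h = [:- \<xi>, 0, 0, 0, 0, 1:] * 1"
    unfolding h_def mu5[symmetric] by (simp add: eval_nat_numeral)
  then have "ev [:- \<mu>, 1:] * ev h = 0"
    using root[of 1] by (simp only: ev_mult[symmetric])
  then have "ev [:- \<mu>, 1:] * d = 0"
    by (simp only: d_def ev_smult scale_mult_right scale_zero_right)
  then have xd: "x * d = scale \<mu> d"
    by (simp add: left_diff_distrib scale_mult_left)
  have "poly h \<mu> = 5 * \<mu> ^ 4"
    by (simp add: h_def eval_nat_numeral algebra_simps)
  then have "poly (smult c h) \<mu> = 1" using five_neq_0 mu0 by (simp add: c_def)
  then have dd: "d * d = d"
    using ev_eigenvector[OF xd, of "smult c h"] by (simp add: d_def[symmetric])
  have "d * ev n = 0" "ev n * d = 0"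
  proof -
    have "poly n \<mu> = 0"
      unfolding n_def \<mu>_def by (simp add: power2_eq_square power3_eq_cube algebra_simps)
    then show "ev n * d = 0" using ev_eigenvector[OF xd, of n] by simp
    then show "d * ev n = 0" unfolding d_def by (simp add: ev_commute)
  qed
  then have dN: "d * N = 0" by (simp add: N_def flip: mult.assoc)
  \<comment> \<open>Multiplication by \<open>a ^ 2\<close> carries the eigenvalue l q^2 of
    \<open>x\<close> to l, another root of n.\<close>
  have "scale (q ^ 2) (x * (a ^ 2 * d)) = a ^ 2 * (x * d)"
    by (simp add: power_semicommute[OF ax] scale_mult_left flip: mult.assoc)
  also have "\<dots> = scale (q ^ 2) (scale l (a ^ 2 * d))"
    unfolding xd by (simp add: scale_mult_right \<mu>_def mult.commute)
  finally have "x * (a ^ 2 * d) = scale l (a ^ 2 * d)"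
    using q_neq_0 by (simp only: scale_cancel_left) simp
  then have "ev n * (a ^ 2 * d) = scale (poly n l) (a ^ 2 * d)" by (rule ev_eigenvector)
  moreover have "poly n l = 0"
    unfolding n_def by (simp add: power2_eq_square power3_eq_cube algebra_simps)
  ultimately have Nd: "N * d = 0" by (simp add: N_def mult.assoc)

  define g where "g = 1 + N"
  define g' where "g' = 1 - N"
  have gg: "g * g' = 1" "g' * g = 1"
    using NN by (simp_all add: g_def g'_def algebra_simps)
  define y where "y = g * x * g'"
  define k where "k = 1 + scale (q - 1) d"
  \<comment> \<open>This is the only term of (1 + N) a (1 - N) beyond a + N a - a N.\<close>
  have "N * a * N = (a * N + b) * N" by (simp add: b_eq)
  also have "\<dots> = 0" using bN NN by (simp add: distrib_right mult.assoc)
  finally have zg: "a + b = g * a * g'"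
    by (simp add: b_eq g_def g'_def algebra_simps)
  \<comment> \<open>As \<open>d\<close> is idempotent, \<open>k\<close> acts by q on the image of
    \<open>d\<close> and by 1 on that of 1 - d.\<close>
  have kn: "k ^ n = 1 + scale (q ^ n - 1) d" for n
  proof (induction n)
    case (Suc n)
    have "k ^ Suc n = 1 + scale (q - 1) d + scale (q ^ n - 1) d + scale ((q - 1) * (q ^ n - 1)) d"
      by (simp add: Suc k_def[symmetric])
        (simp add: k_def distrib_left distrib_right scale_mult_scale dd add.assoc)
    also have "\<dots> = 1 + scale (q - 1 + (q ^ n - 1) + (q - 1) * (q ^ n - 1)) d"
      by (simp only: scale_left_distrib add.assoc)
    finally show ?case by (simp add: algebra_simps)
  qed simp
  have "smult c h \<noteq> 0" "degree (smult c h) < 5"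
    using five_neq_0 mu0 by (simp_all add: h_def c_def)
  then have d0: "d \<noteq> 0"
    using ev_eq_0_iff[of "smult c h" 0] by (auto simp: d_def)
  have d_not_scalar: "d \<noteq> scale t 1" for t
  proof
    assume t: "d = scale t 1"
    then have "scale t x = scale t (scale \<mu> 1)"
      using xd by (simp add: scale_mult_right mult.commute)
    moreover have "t \<noteq> 0" using t d0 by auto
    ultimately show False using x_not_scalar[of \<mu>] by (simp only: scale_cancel_left) simp
  qed
  have kK: "k \<in> kummer_elements scale 5"
  proof -
    have "k \<noteq> scale t 1" for t
    proof
      assume "k = scale t 1"
      then have "scale (q - 1) d = scale (t - 1) 1"
        by (simp add: k_def scale_left_diff_distrib algebra_simps)
      then have "scale (inverse (q - 1)) (scale (q - 1) d) = scale (inverse (q - 1)) (scale (t - 1) 1)"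
        by (rule arg_cong)
      then show False using q_neq_1 d_not_scalar by simp
    qed
    moreover have "\<exists>t. t \<noteq> 0 \<and> k ^ 5 = scale t 1" by (rule exI[of _ 1]) (simp add: kn q5)
    ultimately show ?thesis by (auto simp: kummer_elements_def)
  qed
  have yK: "y \<in> kummer_elements scale 5"
  proof -
    have "y ^ 5 = scale \<xi> 1"
      unfolding y_def conjugate_power[OF gg(2,1)] x5
      by (simp add: scale_mult_left scale_mult_right gg)
    moreover have "y \<noteq> scale t 1" for t
    proof
      assume "y = scale t 1"
      moreover have "x = (g' * g) * x * (g' * g)" by (simp add: gg)
      then have "x = g' * y * g" by (simp add: y_def mult.assoc)
      ultimately have "x = scale t 1" by (simp add: scale_mult_left scale_mult_right gg)
      then show False using x_not_scalar by blast
    qed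
    ultimately show ?thesis using xi_neq_0 by (auto simp: kummer_elements_def)
  qed
  have dx: "d * x = x * d" unfolding d_def by (rule ev_x_commute)
  have dg: "d * g = d" "g * d = d" "d * g' = d" "g' * d = d"
    using dN Nd by (simp_all add: g_def g'_def algebra_simps)
  have kx: "k * x = x * k"
    by (simp add: k_def distrib_left distrib_right scale_mult_left scale_mult_right dx)
  \<comment> \<open>Since g and its inverse fix \<open>d\<close> on both sides, \<open>d * y\<close>
    and \<open>y * d\<close> both equal \<mu> d.\<close>
  have "d * y = d * x * g'" "y * d = g * (x * d)"
    unfolding y_def by (simp_all add: mult.assoc[symmetric] dg) (simp add: mult.assoc dg)
  then have "d * y = y * d"
    by (simp add: dx xd scale_mult_left scale_mult_right dg)
  then have yk: "y * k = k * y"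
    by (simp add: k_def distrib_left distrib_right scale_mult_left scale_mult_right)
  have "(a + b) * y = g * a * (g' * g) * x * g'" "y * (a + b) = g * x * (g' * g) * a * g'"
    unfolding zg y_def by (simp_all only: mult.assoc)
  then have zy: "(a + b) * y = scale q (y * (a + b))"
    by (simp add: gg ax mult.assoc[of g] scale_mult_left scale_mult_right)
  have "linked x k" "linked k y" "linked y (a + b)"
    unfolding linked_def using x_kummer kK yK z kx yk zy q5
    by (auto intro: exI[of _ 1])
  then show ?thesis by (blast intro: tranclp.r_into_trancl tranclp.trancl_into_trancl)
qed

end

section \<open>The relations between the two components\<close>

text \<open>\<open>words_sum a b i j\<close> is the sum of all words with \<open>i\<close> letters \<open>a\<close> and \<open>j\<close> letters \<open>b\<close>. In
  \<open>prefix_sum\<close> each word is weighted with the sum, over all its prefixes, of \<open>q\<close> and \<open>r\<close> to the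
  number of letters \<open>a\<close> and \<open>b\<close> in the prefix; this is what remains of \<open>z\<^sup>k x z\<^sup>n\<^sup>-\<^sup>k\<close>, summed over
  \<open>k\<close>, after \<open>x\<close> is moved to the front.\<close>

fun words_sum :: "'a::ring_1 \<Rightarrow> 'a \<Rightarrow> nat \<Rightarrow> nat \<Rightarrow> 'a" where
  "words_sum a b 0 0 = 1"
| "words_sum a b (Suc i) 0 = a * words_sum a b i 0"
| "words_sum a b 0 (Suc j) = b * words_sum a b 0 j"
| "words_sum a b (Suc i) (Suc j) = a * words_sum a b i (Suc j) + b * words_sum a b (Suc i) j"

context assoc_algebra
begin

fun prefix_sum :: "'f \<Rightarrow> 'f \<Rightarrow> 'a \<Rightarrow> 'a \<Rightarrow> nat \<Rightarrow> nat \<Rightarrow> 'a" where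
  "prefix_sum q r a b 0 0 = 1"
| "prefix_sum q r a b (Suc i) 0 = a * (words_sum a b i 0 + scale q (prefix_sum q r a b i 0))"
| "prefix_sum q r a b 0 (Suc j) = b * (words_sum a b 0 j + scale r (prefix_sum q r a b 0 j))"
| "prefix_sum q r a b (Suc i) (Suc j) =
     a * (words_sum a b i (Suc j) + scale q (prefix_sum q r a b i (Suc j)))
     + b * (words_sum a b (Suc i) j + scale r (prefix_sum q r a b (Suc i) j))"

lemma power5_words:
  "(a + b) ^ 5 = words_sum a b 5 0 + words_sum a b 4 1 + words_sum a b 3 2
     + words_sum a b 2 3 + words_sum a b 1 4 + words_sum a b 0 5" for a b :: 'a
  by (simp add: eval_nat_numeral algebra_simps)

text \<open>The k-th summand weights the first k letters of each word of length 4. The empty prefix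
  counts and the full word does too, which gives five summands.\<close>

lemma power_sum_prefix:
  "(\<Sum>k<5. (scale q a + scale r b) ^ k * (a + b) ^ (4 - k)) = (\<Sum>n<5. prefix_sum q r a b (4 - n) n)"
  by (simp add: eval_nat_numeral lessThan_Suc algebra_simps scale_mult_left scale_mult_right
      scale_right_distrib)

lemma semicommute_mult:
  "u * x = scale \<mu> (x * u) \<Longrightarrow> w * x = scale \<nu> (x * w) \<Longrightarrow> \<kappa> = \<mu> * \<nu>
     \<Longrightarrow> u * w * x = scale \<kappa> (x * (u * w))"
proof -
  assume u: "u * x = scale \<mu> (x * u)" and w: "w * x = scale \<nu> (x * w)" and k: "\<kappa> = \<mu> * \<nu>"
  have "u * w * x = scale \<nu> (u * x * w)" by (simp add: mult.assoc w scale_mult_right)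
  then show "u * w * x = scale \<kappa> (x * (u * w))"
    by (simp add: u k scale_mult_left mult.assoc mult.commute)
qed

lemma semicommute_add:
  "u * x = scale \<mu> (x * u) \<Longrightarrow> w * x = scale \<mu> (x * w) \<Longrightarrow> (u + w) * x = scale \<mu> (x * (u + w))"
  by (simp add: distrib_left distrib_right scale_right_distrib)

lemma semicommute_scale:
  "w * x = scale \<mu> (x * w) \<Longrightarrow> scale c w * x = scale \<mu> (x * scale c w)"
  by (simp add: scale_mult_left scale_mult_right mult.commute)

lemma words_sum_semicommute:
  assumes "a * x = scale q (x * a)" "b * x = scale r (x * b)"
  shows "words_sum a b i j * x = scale (q ^ i * r ^ j) (x * words_sum a b i j)"
  using assms
proof (induction a b i j rule: words_sum.induct)
  case (1 a b)
  then show ?case by simp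
next
  case (2 a b i)
  then show ?case by (auto intro: semicommute_mult)
next
  case (3 a b j)
  then show ?case by (auto intro: semicommute_mult)
next
  case (4 a b i j)
  show ?case unfolding words_sum.simps
    by (intro semicommute_add semicommute_mult[OF 4(3) 4(1)[OF 4(3,4)]]
        semicommute_mult[OF 4(4) 4(2)[OF 4(3,4)]]) simp_all
qed

lemma prefix_sum_semicommute:
  assumes ax: "a * x = scale q (x * a)" and bx: "b * x = scale r (x * b)"
  shows "prefix_sum q' r' a b i j * x = scale (q ^ i * r ^ j) (x * prefix_sum q' r' a b i j)"
  using assms
proof (induction q' r' a b i j rule: prefix_sum.induct)
  case (1 q' r' a b)
  then show ?case by simp
next
  case (2 q' r' a b i)
  show ?case unfolding prefix_sum.simps
    by (rule semicommute_mult[OF 2(2), where \<nu> = "q ^ i * r ^ 0"])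
      (intro semicommute_add semicommute_scale 2 words_sum_semicommute, simp)
next
  case (3 q' r' a b j)
  show ?case unfolding prefix_sum.simps
    by (rule semicommute_mult[OF 3(3), where \<nu> = "q ^ 0 * r ^ j"])
      (intro semicommute_add semicommute_scale 3 words_sum_semicommute, simp)
next
  case (4 q' r' a b i j)
  show ?case unfolding prefix_sum.simps
    by (intro semicommute_add semicommute_mult[OF 4(3), where \<nu> = "q ^ i * r ^ Suc j"]
        semicommute_mult[OF 4(4), where \<nu> = "q ^ Suc i * r ^ j"]
        semicommute_scale 4 words_sum_semicommute) simp_all
qed

text \<open>With \<mu> = r / q, the sum of the words of length d with n letters \<open>b\<close> has
  eigenvalue q^d \<mu>^n under \<open>x\<close>. In length 4 this separates all n; in length 5 only
  n = 0 and n = 5 coincide.\<close>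

lemma binary_sum_relations:
  assumes five: "(5::'f) \<noteq> 0" and q: "q ^ 5 = 1" and r: "r ^ 5 = 1" and "q \<noteq> r"
    and cancel: "\<And>w. x * w = 0 \<Longrightarrow> w = 0"
    and ax: "a * x = scale q (x * a)" and bx: "b * x = scale r (x * b)"
    and trace: "(\<Sum>k<5. (a + b) ^ k * x * (a + b) ^ (4 - k)) = 0"
    and c: "(a + b) ^ 5 = scale c 1"
  shows "n < 5 \<Longrightarrow> prefix_sum q r a b (4 - n) n = 0" "a ^ 5 + b ^ 5 = scale c 1"
proof -
  define \<mu> where "\<mu> = r * inverse q"
  have q0: "q \<noteq> 0" using q by auto
  have mu: "\<mu> ^ 5 = 1" "\<mu> \<noteq> 1"
    using q r q0 \<open>q \<noteq> r\<close> by (auto simp: \<mu>_def power_mult_distrib power_inverse field_simps)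
  have power_cancel: "x ^ n * w = 0 \<Longrightarrow> w = 0" for n w
    by (induction n) (auto simp: mult.assoc dest: cancel)
  have shift: "q ^ (d - n) * r ^ n = q ^ d * \<mu> ^ n" if "n \<le> d" for d n
  proof -
    have "q ^ d = q ^ (d - n) * q ^ n" using that by (simp flip: power_add)
    then show ?thesis using q0 by (simp add: \<mu>_def power_mult_distrib power_inverse)
  qed
  have "(a + b) ^ k * x = x * (scale q a + scale r b) ^ k" for k
  proof (induction k)
    case (Suc k)
    have "(a + b) * x = x * (scale q a + scale r b)"
      by (simp add: ax bx distrib_left distrib_right scale_mult_right)
    then show ?case using Suc by (simp add: mult.assoc) (simp flip: mult.assoc)
  qed simp
  then have "x * (\<Sum>k<5. (scale q a + scale r b) ^ k * (a + b) ^ (4 - k)) = 0"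
    using trace by (simp add: sum_distrib_left mult.assoc)
  then have sum: "(\<Sum>n<5. prefix_sum q r a b (4 - n) n) = 0"
    unfolding power_sum_prefix by (rule cancel)
  show "prefix_sum q r a b (4 - n) n = 0" if "n < 5"
  proof (rule power_cancel, rule eigencomponents_eq_0[OF mu five _ sum _ that])
    show "prefix_sum q r a b (4 - n) n * x
        = scale (q ^ 4 * \<mu> ^ n) (x * prefix_sum q r a b (4 - n) n)" if "n < 5" for n
      using prefix_sum_semicommute[OF ax bx] shift[of n 4] that by simp
  qed (use q0 in simp)
  \<comment> \<open>\<open>a ^ 5\<close>, \<open>b ^ 5\<close> and the scalar all commute with
    \<open>x\<close>, so they share index 0.\<close>
  define w where "w n = (if n = 0 then a ^ 5 + b ^ 5 - scale c 1 else words_sum a b (5 - n) n)" for n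
  have "words_sum a b 5 0 = a ^ 5" "words_sum a b 0 5 = b ^ 5"
    by (simp_all add: eval_nat_numeral)
  then have "(\<Sum>n<5. w n) = (a + b) ^ 5 - scale c 1"
    unfolding power5_words by (simp add: w_def lessThan_nat_numeral)
  then have sum5: "(\<Sum>n<5. w n) = 0" using c by simp
  have "w 0 = 0"
  proof (rule power_cancel, rule eigencomponents_eq_0[OF mu five _ sum5])
    show "w n * x = scale (1 * \<mu> ^ n) (x * w n)" if "n < 5" for n
    proof (cases "n = 0")
      case True
      show ?thesis using power_semicommute(1)[OF ax, of 5] power_semicommute(1)[OF bx, of 5] q r
        by (simp add: w_def True algebra_simps scale_mult_left scale_mult_right)
    next
      case False
      then show ?thesis
        using words_sum_semicommute[OF ax bx] shift[of n 5] that q by (simp add: w_def)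
    qed
  qed simp_all
  then show "a ^ 5 + b ^ 5 = scale c 1" by (simp add: w_def)
qed

end

section \<open>The relations as polynomial identities\<close>

definition dilate :: "'f::field \<Rightarrow> 'f poly \<Rightarrow> 'f poly" where
  "dilate t p = pcompose p [:0, t:]"

lemma dilate_0 [simp]: "dilate t 0 = 0"
  by (simp add: dilate_def)

lemma dilate_pCons [simp]: "dilate t (pCons c p) = pCons c (smult t (dilate t p))"
  by (simp add: dilate_def pcompose_pCons)

lemma dilate_1 [simp]: "dilate t 1 = 1"
  by (simp add: one_pCons)

lemma degree_dilate: "degree (dilate t p) \<le> degree p"
  unfolding dilate_def using degree_pcompose_le[of p "[:0, t:]"] by (auto split: if_splits)

text \<open>The same sums for \<open>b = f(x) a\<^sup>m\<close> and \<open>r = q\<^sup>m\<close>, with the powers of \<open>a\<close> moved to the right.\<close>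

fun words_poly :: "'f::field \<Rightarrow> 'f \<Rightarrow> 'f poly \<Rightarrow> nat \<Rightarrow> nat \<Rightarrow> 'f poly" where
  "words_poly q r f 0 0 = 1"
| "words_poly q r f (Suc i) 0 = dilate q (words_poly q r f i 0)"
| "words_poly q r f 0 (Suc j) = f * dilate r (words_poly q r f 0 j)"
| "words_poly q r f (Suc i) (Suc j) =
     dilate q (words_poly q r f i (Suc j)) + f * dilate r (words_poly q r f (Suc i) j)"

fun prefix_poly :: "'f::field \<Rightarrow> 'f \<Rightarrow> 'f poly \<Rightarrow> nat \<Rightarrow> nat \<Rightarrow> 'f poly" where
  "prefix_poly q r f 0 0 = 1"
| "prefix_poly q r f (Suc i) 0 =
     dilate q (words_poly q r f i 0 + smult q (prefix_poly q r f i 0))"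
| "prefix_poly q r f 0 (Suc j) =
     f * dilate r (words_poly q r f 0 j + smult r (prefix_poly q r f 0 j))"
| "prefix_poly q r f (Suc i) (Suc j) =
     dilate q (words_poly q r f i (Suc j) + smult q (prefix_poly q r f i (Suc j)))
     + f * dilate r (words_poly q r f (Suc i) j + smult r (prefix_poly q r f (Suc i) j))"

lemma degree_mult_bound:
  "degree f \<le> d \<Longrightarrow> degree p \<le> j * d \<Longrightarrow> degree (f * p) \<le> Suc j * d"
  using degree_mult_le[of f p] by simp

lemma degree_words_poly:
  assumes "degree f \<le> d"
  shows "degree (words_poly q r f i j) \<le> j * d"
  using assms
proof (induction q r f i j rule: words_poly.induct)
  case (1 q r f)
  then show ?case by simp
qed (unfold words_poly.simps,
  (intro degree_add_le degree_mult_bound order_trans[OF degree_dilate]; blast)+)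

lemma degree_dilate_add_smult:
  "degree p \<le> n \<Longrightarrow> degree r \<le> n \<Longrightarrow> degree (dilate t (p + smult c r)) \<le> n"
  by (intro order_trans[OF degree_dilate] degree_add_le order_trans[OF degree_smult_le])

text \<open>Keeps the degree below 10 for one or two letters \<open>b\<close> with d = 4 or 3, and
  for three with d = 3, so that a single reduction by x^5 suffices.\<close>

lemma degree_prefix_poly:
  assumes "degree f \<le> d"
  shows "degree (prefix_poly q r f i j) \<le> j * d"
  using assms
proof (induction q r f i j rule: prefix_poly.induct)
  case (1 q r f)
  then show ?case by simp
qed (unfold prefix_poly.simps,
  (intro degree_add_le degree_mult_bound degree_dilate_add_smult degree_words_poly; blast)+)

context kummer_pair
begin

lemma ev_1 [simp]: "ev 1 = 1"
  by (simp add: one_pCons)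

text \<open>Moving powers of \<open>a\<close> to the right past F[x] dilates the polynomials, so
  both recursions take the same steps; each letter \<open>b\<close> contributes
  \<open>a ^ m\<close>.\<close>

lemma prefix_sum_eq_ev:
  "prefix_sum q (q ^ m) a (ev f * a ^ m) i j = ev (prefix_poly q (q ^ m) f i j) * a ^ (i + m * j)"
proof -
  have step_a: "a * (ev p * a ^ n) = ev (dilate q p) * a ^ Suc n" for p n
    using a_power_ev[of 1 p] by (simp add: dilate_def mult.assoc flip: mult.assoc[of a])
  have step_b: "ev f * a ^ m * (ev p * a ^ n) = ev (f * dilate (q ^ m) p) * a ^ (m + n)" for p n
  proof -
    have "ev f * a ^ m * (ev p * a ^ n) = ev f * (a ^ m * ev p) * a ^ n"
      by (simp only: mult.assoc)
    then show ?thesis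
      by (simp only: a_power_ev dilate_def ev_mult power_add mult.assoc)
  qed
  define b where "b = ev f * a ^ m"
  note step_b = step_b[folded b_def]
  define r where "r = q ^ m"
  note step_b = step_b[folded r_def]
  have words: "words_sum a b i j = ev (words_poly q r f i j) * a ^ (i + m * j)" for i j
  proof (induction j arbitrary: i)
    case 0
    show ?case
    proof (induction i)
      case (Suc i)
      show ?case
        using step_a[of "words_poly q r f i 0" i]
        by (simp add: Suc del: power_Suc)
    qed simp
  next
    case IHj: (Suc j)
    show ?case
    proof (induction i)
      case 0
      have "words_sum a b 0 (Suc j) = b * (ev (words_poly q r f 0 j) * a ^ (0 + m * j))"
        by (simp only: words_sum.simps IHj)
      then show ?case by (simp add: step_b)
    next
      case (Suc i)
      have "words_sum a b (Suc i) (Suc j)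
          = a * (ev (words_poly q r f i (Suc j)) * a ^ (i + m * Suc j))
            + b * (ev (words_poly q r f (Suc i) j) * a ^ (Suc i + m * j))"
        by (simp only: words_sum.simps Suc IHj)
      also have "\<dots> = ev (words_poly q r f (Suc i) (Suc j)) * a ^ (Suc i + m * Suc j)"
        unfolding step_a step_b by (simp add: ev_add distrib_right add_ac del: power_Suc)
      finally show ?case .
    qed
  qed
  have comb: "ev p * w + scale c (ev p' * w) = ev (p + smult c p') * w" for p p' w c
    by (simp add: ev_add ev_smult distrib_right scale_mult_left)
  have prefixes: "prefix_sum q r a b i j = ev (prefix_poly q r f i j) * a ^ (i + m * j)" for i j
  proof (induction j arbitrary: i)
    case 0
    show ?case
    proof (induction i)
      case (Suc i)
      show ?case
        using step_a[of "words_poly q r f i 0 + smult q (prefix_poly q r f i 0)" i]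
        by (simp add: Suc words comb del: power_Suc)
    qed simp
  next
    case IHj: (Suc j)
    show ?case
    proof (induction i)
      case 0
      have "prefix_sum q r a b 0 (Suc j)
          = b * (ev (words_poly q r f 0 j + smult r (prefix_poly q r f 0 j)) * a ^ (0 + m * j))"
        by (simp only: prefix_sum.simps IHj words comb)
      then show ?case by (simp add: step_b)
    next
      case (Suc i)
      have "prefix_sum q r a b (Suc i) (Suc j)
          = a * (ev (words_poly q r f i (Suc j) + smult q (prefix_poly q r f i (Suc j)))
              * a ^ (i + m * Suc j))
            + b * (ev (words_poly q r f (Suc i) j + smult r (prefix_poly q r f (Suc i) j))
              * a ^ (Suc i + m * j))"
        by (simp only: prefix_sum.simps Suc IHj words comb)
      also have "\<dots> = ev (prefix_poly q r f (Suc i) (Suc j)) * a ^ (Suc i + m * Suc j)"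
        unfolding step_a step_b by (simp add: ev_add distrib_right add_ac del: power_Suc)
      finally show ?case .
    qed
  qed
  then show "prefix_sum q (q ^ m) a (ev f * a ^ m) i j
      = ev (prefix_poly q (q ^ m) f i j) * a ^ (i + m * j)"
    by (simp only: b_def r_def)
qed

text \<open>Since x^5 = \<xi>, the coefficient at k + 5 is folded onto the one at k, and the reduced
  polynomial has degree below 5.\<close>

lemma coeff_eq_0_reduce:
  assumes "ev p * a ^ n = 0" "degree p < 10" "k < 5"
  shows "coeff p k + \<xi> * coeff p (k + 5) = 0"
proof -
  have "p = (\<Sum>i\<le>9. monom (coeff p i) i)"
    using poly_as_sum_of_monoms'[of p 9] assms(2) by simp
  also have "\<dots> = [:coeff p 0, coeff p 1, coeff p 2, coeff p 3, coeff p 4,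
      coeff p 5, coeff p 6, coeff p 7, coeff p 8, coeff p 9:]"
    by (simp add: monom_altdef eval_nat_numeral)
  finally have "ev p = ev [:coeff p 0 + \<xi> * coeff p 5, coeff p 1 + \<xi> * coeff p 6,
      coeff p 2 + \<xi> * coeff p 7, coeff p 3 + \<xi> * coeff p 8, coeff p 4 + \<xi> * coeff p 9:]"
    (is "_ = ev ?r") using ev_reduce by metis
  then have "?r = 0" using assms(1) by (intro ev_eq_0_iff) auto
  moreover have "k = 0 \<or> k = 1 \<or> k = 2 \<or> k = 3 \<or> k = 4" using assms(3) by linarith
  ultimately show ?thesis by auto
qed

end

section \<open>The coefficient equations\<close>

text \<open>In \<open>prefix_poly_i_j_coeff_m_k\<close>, the equation comes from the words with \<open>i\<close> letters \<open>a\<close> and \<open>j\<close>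
  letters \<open>b = f(x) a\<^sup>m\<close>, at \<open>x\<^sup>k\<close>. The parameter \<open>t\<close> stands for \<open>x\<^sup>5\<close>. The relation for \<open>(3, 1)\<close> is
  linear in \<open>f\<close>; it removes the coefficients \<open>f0\<close> and \<open>f4\<close>.\<close>

lemma prefix_poly_3_1_coeff_0_0:
  fixes q :: "'f::field"
  assumes phi: "1 + q + q ^ 2 + q ^ 3 + q ^ 4 = 0"
    and c: "coeff (prefix_poly q (q ^ 0) [:f0, f1, f2, f3, f4:] 3 1) 0 = 0"
  shows "5 * f0 = 0"
  using c by (simp add: one_pCons eval_nat_numeral algebra_simps del: mult_eq_0_iff)
    (use phi in algebra)

lemma prefix_poly_3_1_coeff_0_4:
  fixes q :: "'f::field"
  assumes phi: "1 + q + q ^ 2 + q ^ 3 + q ^ 4 = 0"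
    and c: "coeff (prefix_poly q (q ^ 0) [:f0, f1, f2, f3, f4:] 3 1) 4 = 0"
  shows "5 * f4 = 0"
  using c by (simp add: one_pCons eval_nat_numeral algebra_simps del: mult_eq_0_iff)
    (use phi in algebra)

lemma prefix_poly_3_1_coeff_2_0:
  fixes q :: "'f::field"
  assumes phi: "1 + q + q ^ 2 + q ^ 3 + q ^ 4 = 0"
    and c: "coeff (prefix_poly q (q ^ 2) [:f0, f1, f2, f3, f4:] 3 1) 0 = 0"
  shows "5 * f0 = 0"
  using c by (simp add: one_pCons eval_nat_numeral algebra_simps del: mult_eq_0_iff)
    (use phi in algebra)

lemma prefix_poly_3_1_coeff_2_4:
  fixes q :: "'f::field"
  assumes phi: "1 + q + q ^ 2 + q ^ 3 + q ^ 4 = 0"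
    and c: "coeff (prefix_poly q (q ^ 2) [:f0, f1, f2, f3, f4:] 3 1) 4 = 0"
  shows "5 * f4 = 0"
  using c by (simp add: one_pCons eval_nat_numeral algebra_simps del: mult_eq_0_iff)
    (use phi in algebra)

lemma prefix_poly_3_1_coeff_3_0:
  fixes q :: "'f::field"
  assumes phi: "1 + q + q ^ 2 + q ^ 3 + q ^ 4 = 0"
    and c: "coeff (prefix_poly q (q ^ 3) [:f0, f1, f2, f3, f4:] 3 1) 0 = 0"
  shows "5 * f0 = 0"
  using c by (simp add: one_pCons eval_nat_numeral algebra_simps del: mult_eq_0_iff)
    (use phi in algebra)

lemma prefix_poly_3_1_coeff_3_4:
  fixes q :: "'f::field"
  assumes phi: "1 + q + q ^ 2 + q ^ 3 + q ^ 4 = 0"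
    and c: "coeff (prefix_poly q (q ^ 3) [:f0, f1, f2, f3, f4:] 3 1) 4 = 0"
  shows "5 * f4 = 0"
  using c by (simp add: one_pCons eval_nat_numeral algebra_simps del: mult_eq_0_iff)
    (use phi in algebra)

lemma prefix_poly_3_1_coeff_4_0:
  fixes q :: "'f::field"
  assumes phi: "1 + q + q ^ 2 + q ^ 3 + q ^ 4 = 0"
    and c: "coeff (prefix_poly q (q ^ 4) [:f0, f1, f2, f3, f4:] 3 1) 0 = 0"
  shows "5 * f0 = 0"
  using c by (simp add: one_pCons eval_nat_numeral algebra_simps del: mult_eq_0_iff)
    (use phi in algebra)

lemma prefix_poly_3_1_coeff_4_4:
  fixes q :: "'f::field"
  assumes phi: "1 + q + q ^ 2 + q ^ 3 + q ^ 4 = 0"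
    and c: "coeff (prefix_poly q (q ^ 4) [:f0, f1, f2, f3, f4:] 3 1) 4 = 0"
  shows "5 * f4 = 0"
  using c by (simp add: one_pCons eval_nat_numeral algebra_simps del: mult_eq_0_iff)
    (use phi in algebra)

text \<open>With exponents 1, 2, 3 in f and two factors f, only x^2 and x^3 combine to x^5. This
  isolates the product \<open>f2 * f3\<close>, here and for m = 2 and m = 4.\<close>

lemma prefix_poly_2_2_coeff_0_5:
  fixes q :: "'f::field"
  assumes phi: "1 + q + q ^ 2 + q ^ 3 + q ^ 4 = 0"
    and c: "coeff (prefix_poly q (q ^ 0) [:0, f1, f2, f3:] 2 2) 5 = 0"
  shows "5 * f2 * f3 = 0"
  using c by (simp add: one_pCons eval_nat_numeral algebra_simps del: mult_eq_0_iff)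
    (use phi in algebra)

lemma prefix_poly_2_2_coeff_2_5:
  fixes q :: "'f::field"
  assumes phi: "1 + q + q ^ 2 + q ^ 3 + q ^ 4 = 0"
    and c: "coeff (prefix_poly q (q ^ 2) [:0, f1, f2, f3:] 2 2) 5 = 0"
  shows "5 * f2 * f3 = 0"
  using c by (simp add: one_pCons eval_nat_numeral algebra_simps del: mult_eq_0_iff)
    (use phi in algebra)

lemma prefix_poly_2_2_coeff_4_5:
  fixes q :: "'f::field"
  assumes phi: "1 + q + q ^ 2 + q ^ 3 + q ^ 4 = 0"
    and c: "coeff (prefix_poly q (q ^ 4) [:0, f1, f2, f3:] 2 2) 5 = 0"
  shows "5 * f2 * f3 = 0"
  using c by (simp add: one_pCons eval_nat_numeral algebra_simps del: mult_eq_0_iff)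
    (use phi in algebra)

text \<open>At x^4 only \<open>f1 * f3\<close> and \<open>f2 ^ 2\<close> arise; likewise in the next
  two lemmas.\<close>

lemma prefix_poly_2_2_coeff_2_4:
  fixes q :: "'f::field"
  assumes phi: "1 + q + q ^ 2 + q ^ 3 + q ^ 4 = 0"
    and c: "coeff (prefix_poly q (q ^ 2) [:0, f1, f2, f3:] 2 2) 4 = 0"
  shows "5 * (q * f1 * f3 - (1 + q ^ 2) * f2 ^ 2) = 0"
  using c by (simp add: one_pCons eval_nat_numeral algebra_simps del: mult_eq_0_iff)
    (use phi in algebra)

lemma prefix_poly_2_2_coeff_4_4:
  fixes q :: "'f::field"
  assumes phi: "1 + q + q ^ 2 + q ^ 3 + q ^ 4 = 0"
    and c: "coeff (prefix_poly q (q ^ 4) [:0, f1, f2, f3:] 2 2) 4 = 0"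
  shows "5 * (q ^ 2 * f2 ^ 2 - (q + q ^ 2 + q ^ 3) * f1 * f3) = 0"
  using c by (simp add: one_pCons eval_nat_numeral algebra_simps del: mult_eq_0_iff)
    (use phi in algebra)

lemma prefix_poly_2_2_coeff_0_4:
  fixes q :: "'f::field"
  assumes phi: "1 + q + q ^ 2 + q ^ 3 + q ^ 4 = 0"
    and c: "coeff (prefix_poly q (q ^ 0) [:0, f1, f2, f3:] 2 2) 4 = 0"
  shows "5 * (2 * f1 * f3 + f2 ^ 2) = 0"
  using c by (simp add: one_pCons eval_nat_numeral algebra_simps del: mult_eq_0_iff)
    (use phi in algebra)

text \<open>Three factors f give x^4 only as \<open>f1 ^ 2 * f2\<close> and x^9 only as
  \<open>f3 ^ 3\<close>; the latter is folded onto x^4.\<close>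

lemma prefix_poly_1_3_coeff_0_4:
  fixes q :: "'f::field"
  assumes phi: "1 + q + q ^ 2 + q ^ 3 + q ^ 4 = 0"
    and c: "coeff (prefix_poly q (q ^ 0) [:0, f1, f2, f3:] 1 3) 4
      + t * coeff (prefix_poly q (q ^ 0) [:0, f1, f2, f3:] 1 3) 9 = 0"
  shows "5 * (3 * f1 ^ 2 * f2 + t * f3 ^ 3) = 0"
  using c by (simp add: one_pCons eval_nat_numeral algebra_simps del: mult_eq_0_iff)
    (use phi in algebra)

lemma prefix_poly_1_3_coeff_3_4:
  fixes q :: "'f::field"
  assumes phi: "1 + q + q ^ 2 + q ^ 3 + q ^ 4 = 0"
    and c: "coeff (prefix_poly q (q ^ 3) [:0, f1, f2, f3:] 1 3) 4
      + t * coeff (prefix_poly q (q ^ 3) [:0, f1, f2, f3:] 1 3) 9 = 0"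
  shows "5 * ((1 + q ^ 3) * f1 ^ 2 * f2 - q ^ 4 * t * f3 ^ 3) = 0"
  using c by (simp add: one_pCons eval_nat_numeral algebra_simps del: mult_eq_0_iff)
    (use phi in algebra)

text \<open>Three factors f give x^5 only as \<open>f1 * f2 ^ 2\<close> and
  \<open>f1 ^ 2 * f3\<close>.\<close>

lemma prefix_poly_1_3_coeff_3_5:
  fixes q :: "'f::field"
  assumes phi: "1 + q + q ^ 2 + q ^ 3 + q ^ 4 = 0"
    and c: "coeff (prefix_poly q (q ^ 3) [:0, f1, f2, f3:] 1 3) 5 = 0"
  shows "5 * (f1 * ((1 + q ^ 2 + q ^ 3) * f2 ^ 2 - (q ^ 2 + q ^ 3) * f1 * f3)) = 0"
  using c by (simp add: one_pCons eval_nat_numeral algebra_simps del: mult_eq_0_iff)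
    (use phi in algebra)

section \<open>Solving the coefficient equations\<close>

context kummer_pair
begin

text \<open>The exponent 1 is absent because the two eigenvalues differ. For m = 0, 2, 4 the
  equations force f to be a monomial; for m = 3 they also admit the cubics of
  \<open>linked_conjugate\<close>.\<close>

lemma linked_sum:
  assumes m: "m \<in> {0, 2, 3, 4}" and bx: "b * x = scale (q ^ m) (x * b)" and b0: "b \<noteq> 0"
    and rel: "\<And>n. n < 5 \<Longrightarrow> prefix_sum q (q ^ m) a b (4 - n) n = 0"
    and z: "a + b \<in> kummer_elements scale 5"
  shows "linked\<^sup>+\<^sup>+ x (a + b)"
proof -
  note phi = sum_fifth_root[OF q5 q_neq_1]
  have cancel5: "w = 0" if "5 * w = 0" for w :: 'f using that five_neq_0 by simp
  have root: "q ^ d \<noteq> 1" if "0 < d" "d < 5" for d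
    using fifth_root_power_neq_1[OF q5 q_neq_1 that] .
  \<comment> \<open>These factors are cancelled in the case distinction on m.\<close>
  have q1: "1 + q \<noteq> 0"
  proof
    assume "1 + q = 0"
    then have "q ^ 2 = 1" by algebra
    then show False using root[of 2] by simp
  qed
  have q2: "1 + q ^ 2 \<noteq> 0"
  proof
    assume "1 + q ^ 2 = 0"
    then have "q ^ 4 = 1" by algebra
    then show False using root[of 4] by simp
  qed
  have q3: "1 + q ^ 3 \<noteq> 0"
  proof
    assume "1 + q ^ 3 = 0"
    then have "q = 1" using phi by algebra
    then show False using q_neq_1 by simp
  qed
  have q12: "1 + q + q ^ 2 \<noteq> 0"
  proof
    assume "1 + q + q ^ 2 = 0"
    then have "q ^ 3 = 1" by algebra
    then show False using root[of 3] by simp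
  qed
  have "m < 5" using m by auto
  then obtain f where f: "degree f < 5" "b = ev f * a ^ m"
    using eigenvector_expansion[OF bx] by blast
  have rel': "coeff (prefix_poly q (q ^ m) f (4 - n) n) k
      + \<xi> * coeff (prefix_poly q (q ^ m) f (4 - n) n) (k + 5) = 0"
    if "n < 5" "k < 5" "degree f \<le> d" "n * d < 10" for n k d
    using rel[OF that(1)] that degree_prefix_poly[OF that(3), of q "q ^ m" "4 - n" n]
    unfolding f(2) prefix_sum_eq_ev by (intro coeff_eq_0_reduce) auto
  have high: "coeff (prefix_poly q (q ^ m) f (4 - n) n) k = 0" if "degree f \<le> d" "n * d < k" for n d k
    using degree_prefix_poly[OF that(1), of q "q ^ m" "4 - n" n] that(2) by (intro coeff_eq_0) linarith
  obtain f0 f1 f2 f3 f4 where f_eq: "f = [:f0, f1, f2, f3, f4:]"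
  proof
    have "f = (\<Sum>i\<le>4. monom (coeff f i) i)"
      using poly_as_sum_of_monoms'[of f 4] f(1) by simp
    then show "f = [:coeff f 0, coeff f 1, coeff f 2, coeff f 3, coeff f 4:]"
      by (simp add: monom_altdef eval_nat_numeral)
  qed
  \<comment> \<open>One letter \<open>b\<close> gives degree at most 4, so nothing is
    folded.\<close>
  have "coeff (prefix_poly q (q ^ m) f 3 1) k = 0" if "k < 5" for k
    using rel'[of 1 k 4] high[of 4 1 "k + 5"] f(1) that by simp
  then have c0: "coeff (prefix_poly q (q ^ m) [:f0, f1, f2, f3, f4:] 3 1) 0 = 0"
    and c4: "coeff (prefix_poly q (q ^ m) [:f0, f1, f2, f3, f4:] 3 1) 4 = 0"
    unfolding f_eq by simp_all
  consider "m = 0" | "m = 2" | "m = 3" | "m = 4" using m by blast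
  then have "5 * f0 = 0 \<and> 5 * f4 = 0"
  proof cases
    case 1 show ?thesis
      using prefix_poly_3_1_coeff_0_0[OF phi c0[unfolded 1]]
        prefix_poly_3_1_coeff_0_4[OF phi c4[unfolded 1]] ..
  next
    case 2 show ?thesis
      using prefix_poly_3_1_coeff_2_0[OF phi c0[unfolded 2]]
        prefix_poly_3_1_coeff_2_4[OF phi c4[unfolded 2]] ..
  next
    case 3 show ?thesis
      using prefix_poly_3_1_coeff_3_0[OF phi c0[unfolded 3]]
        prefix_poly_3_1_coeff_3_4[OF phi c4[unfolded 3]] ..
  next
    case 4 show ?thesis
      using prefix_poly_3_1_coeff_4_0[OF phi c0[unfolded 4]]
        prefix_poly_3_1_coeff_4_4[OF phi c4[unfolded 4]] ..
  qed
  then have f_eq: "f = [:0, f1, f2, f3:]" using f_eq five_neq_0 by simp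
  have deg: "degree f \<le> 3" unfolding f_eq by simp
  have r22_4: "coeff (prefix_poly q (q ^ m) [:0, f1, f2, f3:] 2 2) 4 = 0"
    using rel'[of 2 4 3] high[of 3 2 9] deg unfolding f_eq by simp
  \<comment> \<open>As f has no constant term, the relation at x^0 consists of the folded
    coefficient of x^5 alone.\<close>
  have "coeff (prefix_poly q (q ^ m) [:0, f1, f2, f3:] 2 2) 0 = 0"
    "coeff (prefix_poly q (q ^ m) [:0, f1, f2, f3:] 1 3) 0 = 0"
    by (simp_all add: eval_nat_numeral)
  then have r22_5: "coeff (prefix_poly q (q ^ m) [:0, f1, f2, f3:] 2 2) 5 = 0"
    and r13_5: "coeff (prefix_poly q (q ^ m) [:0, f1, f2, f3:] 1 3) 5 = 0"
    using rel'[of 2 0 3] rel'[of 3 0 3] deg xi_neq_0 unfolding f_eq by simp_all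
  have r13_4: "coeff (prefix_poly q (q ^ m) [:0, f1, f2, f3:] 1 3) 4
      + \<xi> * coeff (prefix_poly q (q ^ m) [:0, f1, f2, f3:] 1 3) 9 = 0"
    using rel'[of 3 4 3] deg unfolding f_eq by simp
  have single: "linked\<^sup>+\<^sup>+ x (a + b)" if mono: "f = monom c s" "0 < s" "s < 5" for c s
  proof -
    have b: "b = scale c (x ^ s * a ^ m)"
      unfolding f(2) mono(1) by (simp add: ev_monom scale_mult_left)
    moreover have "c \<noteq> 0" using b b0 by auto
    ultimately show ?thesis using linked_monomial[OF _ mono(2,3)] z by simp
  qed
  have "monom c 1 = [:0, c:]" "monom c 2 = [:0, 0, c:]" "monom c 3 = [:0, 0, 0, c:]" for c :: 'f
    by (simp_all add: monom_altdef eval_nat_numeral)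
  then have monomial: "linked\<^sup>+\<^sup>+ x (a + b)"
    if "f2 = 0 \<and> f3 = 0 \<or> f1 = 0 \<and> f3 = 0 \<or> f1 = 0 \<and> f2 = 0"
    using that single[of f1 1] single[of f2 2] single[of f3 3] unfolding f_eq by auto
  consider "m = 0" | "m = 2" | "m = 3" | "m = 4" using m by blast
  then show ?thesis
  proof cases
    case 1
    \<comment> \<open>In characteristic 2 the second equation loses \<open>f1 * f3\<close>; the
      cubic one then gives f3 = 0.\<close>
    note prefix_poly_2_2_coeff_0_5[OF phi r22_5[unfolded 1]]
      prefix_poly_2_2_coeff_0_4[OF phi r22_4[unfolded 1], THEN cancel5]
      prefix_poly_1_3_coeff_0_4[OF phi r13_4[unfolded 1], THEN cancel5]
    then have "f2 = 0 \<and> f3 = 0" using xi_neq_0 five_neq_0 by auto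
    then show ?thesis by (intro monomial) simp
  next
    case 2
    note prefix_poly_2_2_coeff_2_5[OF phi r22_5[unfolded 2]]
      prefix_poly_2_2_coeff_2_4[OF phi r22_4[unfolded 2], THEN cancel5]
    then show ?thesis using q2 q_neq_0 five_neq_0 by (intro monomial) auto
  next
    case 4
    have "q + q ^ 2 + q ^ 3 = q * (1 + q + q ^ 2)" by algebra
    then have "q + q ^ 2 + q ^ 3 \<noteq> 0" using q12 q_neq_0 by simp
    moreover note prefix_poly_2_2_coeff_4_5[OF phi r22_5[unfolded 4]]
      prefix_poly_2_2_coeff_4_4[OF phi r22_4[unfolded 4], THEN cancel5]
    ultimately show ?thesis using q_neq_0 five_neq_0 by (intro monomial) auto
  next
    case 3
    note eq4 = prefix_poly_1_3_coeff_3_4[OF phi r13_4[unfolded 3], THEN cancel5]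
      and eq5 = prefix_poly_1_3_coeff_3_5[OF phi r13_5[unfolded 3], THEN cancel5]
    have q23: "q ^ 2 + q ^ 3 = q ^ 2 * (1 + q)" by algebra
    show ?thesis
    proof (cases "f1 = 0 \<or> f2 = 0 \<or> f3 = 0")
      case True
      then show ?thesis using eq4 eq5[unfolded q23] q_neq_0 xi_neq_0 q1 q3 by (intro monomial) auto
    next
      case False
      \<comment> \<open>Read off from the coefficient of X^2 in f3 X (X - l) (X - l q). Then
        \<open>eq5\<close> gives the coefficient of X, and \<open>eq4\<close> gives l^5 =
        \<xi>.\<close>
      define l where "l = - (f2 / (f3 * (1 + q)))"
      have f2: "f2 = - (f3 * l * (1 + q))" using False q1 by (simp add: l_def)
      have "q ^ 2 * (1 + q) * f3 * (f1 - f3 * l ^ 2 * q) = 0"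
        using eq5 False phi unfolding f2 by algebra
      then have f1: "f1 = f3 * l ^ 2 * q" using q_neq_0 q1 False by auto
      have "q ^ 4 * f3 ^ 3 * (l ^ 5 - \<xi>) = 0"
        using eq4 phi unfolding f1 f2 by algebra
      then have "l ^ 5 = \<xi>" using q_neq_0 False by auto
      then show ?thesis
        using linked_conjugate[of l f3 b] False z f(2) 3 unfolding f_eq f1 f2 by auto
    qed
  qed
qed

end

context assoc_algebra
begin

section \<open>Conclusion\<close>

lemma linked_eigencomponents_if_not_nilpotent:
  assumes S: "finite S" "card S \<le> 25" "span S = UNIV"
    and five: "(5::'f) \<noteq> 0" and xi: "\<xi> \<noteq> 0" "x ^ 5 = scale \<xi> 1"
    and q: "q ^ 5 = 1" and r: "r ^ 5 = 1" and qr: "q \<noteq> r"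
    and ax: "a * x = scale q (x * a)" and bx: "b * x = scale r (x * b)"
    and a: "\<And>n. a ^ n \<noteq> 0" and b: "b \<noteq> 0"
    and rel: "\<And>n. n < 5 \<Longrightarrow> prefix_sum q r a b (4 - n) n = 0"
    and z: "a + b \<in> kummer_elements scale 5"
  shows "linked\<^sup>+\<^sup>+ x (a + b)"
proof -
  \<comment> \<open>For q = 1 the relation of the word \<open>a ^ 4\<close> reads 5 a^4 = 0.\<close>
  have q1: "q \<noteq> 1"
  proof
    assume "q = 1"
    then have "a ^ 4 + a ^ 4 + a ^ 4 + a ^ 4 + a ^ 4 = 0"
      using rel[of 0] by (simp add: eval_nat_numeral distrib_left mult_2_right add.assoc)
    then have "scale (1 + 1 + 1 + 1 + 1) (a ^ 4) = 0"
      by (simp only: scale_left_distrib scale_one)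
    then show False using a five by simp
  qed
  interpret kummer_pair scale q \<xi> x a S
    by unfold_locales (use assms q1 in auto)
  \<comment> \<open>X^5 - 1 splits with the powers of q as its roots.\<close>
  have "(r - 1) * (r - q) * (r - q ^ 2) * (r - q ^ 3) * (r - q ^ 4) = 0"
    using sum_fifth_root[OF q q1] r by algebra
  then have "r = q ^ 0 \<or> r = q ^ 2 \<or> r = q ^ 3 \<or> r = q ^ 4" using qr by auto
  then have "\<exists>m\<in>{0, 2, 3, 4}. r = q ^ m" by simp
  then obtain m where m: "m \<in> {0, 2, 3, 4}" "r = q ^ m" ..
  show ?thesis using linked_sum[OF m(1) bx[unfolded m(2)] b rel[unfolded m(2)] z] .
qed

text \<open>The situation is symmetric in \<open>a\<close> and \<open>b\<close>, and they are not
  both nilpotent because a^5 + b^5 is a nonzero scalar.\<close>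

lemma linked_eigencomponents:
  assumes S: "finite S" "card S \<le> 25" "span S = UNIV"
    and five: "(5::'f) \<noteq> 0" and x: "x \<in> kummer_elements scale 5"
    and q: "q ^ 5 = 1" and r: "r ^ 5 = 1" and qr: "q \<noteq> r"
    and ax: "a * x = scale q (x * a)" and bx: "b * x = scale r (x * b)"
    and a: "a \<noteq> 0" and b: "b \<noteq> 0"
    and trace: "(\<Sum>k<5. (a + b) ^ k * x * (a + b) ^ (4 - k)) = 0"
    and z: "a + b \<in> kummer_elements scale 5"
  shows "linked\<^sup>+\<^sup>+ x (a + b)"
proof -
  obtain \<xi> where xi: "\<xi> \<noteq> 0" "x ^ 5 = scale \<xi> 1" using x by (auto simp: kummer_elements_def)
  obtain c where c: "c \<noteq> 0" "(a + b) ^ 5 = scale c 1" using z by (auto simp: kummer_elements_def)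
  have cancel: "w = 0" if "x * w = 0" for w
  proof -
    have "scale \<xi> w = x ^ 5 * w" by (simp add: xi scale_mult_left)
    also have "\<dots> = x ^ 4 * (x * w)" by (simp add: mult.assoc[symmetric] flip: power_Suc2)
    finally show "w = 0" using that xi by simp
  qed
  have rel: "prefix_sum q r a b (4 - n) n = 0" if "n < 5" for n
    by (rule binary_sum_relations(1)[OF five q r qr _ ax bx trace c(2) that]) (rule cancel)
  have rel': "prefix_sum r q b a (4 - n) n = 0" if "n < 5" for n
    by (rule binary_sum_relations(1)[OF five r q qr[symmetric] _ bx ax _ _ that])
      (use trace c(2) cancel in \<open>auto simp: add.commute\<close>)
  have ab: "a ^ 5 + b ^ 5 = scale c 1"
    by (rule binary_sum_relations(2)[OF five q r qr _ ax bx trace c(2)]) (rule cancel)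
  have "(\<forall>n. a ^ n \<noteq> 0) \<or> (\<forall>n. b ^ n \<noteq> 0)"
  proof (rule ccontr)
    assume "\<not> ?thesis"
    then obtain m n where mn: "a ^ m = 0" "b ^ n = 0" by auto
    have "(u ^ 5) ^ k = (u ^ k) ^ 5" for u :: 'a and k
      by (simp only: power_mult[symmetric] mult.commute)
    then have "(a ^ 5) ^ m = 0" "(b ^ 5) ^ n = 0" using mn by simp_all
    moreover have "a ^ 5 * b ^ 5 = b ^ 5 * a ^ 5"
    proof -
      \<comment> \<open>\<open>a\<close> and \<open>b\<close> need not commute, but their fifth
        powers do, as their sum is a scalar.\<close>
      have b5: "b ^ 5 = scale c 1 - a ^ 5" using ab by (simp add: eq_diff_eq add.commute)
      show ?thesis
        unfolding b5 by (simp add: left_diff_distrib right_diff_distrib scale_mult_left scale_mult_right)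
    qed
    ultimately have "scale c 1 ^ (m + n) = (0::'a)"
      using power_eq_0_add[of "a ^ 5" "b ^ 5" m n] ab by simp
    then show False using c by (simp add: power_scale)
  qed
  then show ?thesis
  proof
    assume "\<forall>n. a ^ n \<noteq> 0"
    then show ?thesis
      by (intro linked_eigencomponents_if_not_nilpotent[OF S five xi q r qr ax bx _ b rel z]) auto
  next
    assume "\<forall>n. b ^ n \<noteq> 0"
    then have "linked\<^sup>+\<^sup>+ x (b + a)"
      using z
      by (intro linked_eigencomponents_if_not_nilpotent[OF S five xi r q qr[symmetric] bx ax _ a rel'])
        (auto simp: add.commute)
    then show ?thesis by (simp add: add.commute)
  qed
qed

section \<open>A spanning set of a cyclic algebra\<close>

lemma free_eval_superset:
  assumes "finite A" "Poly_Mapping.keys f \<subseteq> A"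
  shows "free_eval scale x y f = (\<Sum>w\<in>A. scale (Poly_Mapping.lookup f w) (word_eval x y w))"
  unfolding free_eval_def
  by (rule sum.mono_neutral_left) (use assms in \<open>auto simp: in_keys_iff\<close>)

lemma free_eval_single:
  "free_eval scale x y (Poly_Mapping.single w c) = scale c (word_eval x y w)"
  by (subst free_eval_superset[of "{w}"]) auto

lemma free_eval_diff:
  "free_eval scale x y (f - g) = free_eval scale x y f - free_eval scale x y g"
proof -
  let ?A = "Poly_Mapping.keys f \<union> Poly_Mapping.keys g \<union> Poly_Mapping.keys (f - g)"
  have "free_eval scale x y h = (\<Sum>w\<in>?A. scale (Poly_Mapping.lookup h w) (word_eval x y w))"
    if "h \<in> {f, g, f - g}" for h
    using that by (intro free_eval_superset) auto
  then show ?thesis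
    by (simp add: lookup_minus scale_left_diff_distrib flip: sum_subtractf)
qed

text \<open>The span of the monomials X^i Y^j with i, j < 5 contains 1 and, by the three relations,
  is closed under left multiplication by X and Y; hence it contains every word.\<close>

lemma cyclic_algebra_spanning_set:
  assumes "cyclic_algebra scale 5 \<rho>"
  obtains S where "finite S" "card S \<le> 25" "span S = UNIV"
proof -
  obtain \<alpha> \<beta> X Y where surj: "surj (free_eval scale X Y)"
    and ker: "{f. free_eval scale X Y f = 0} = two_sided_ideal hull cyclic_relators 5 \<rho> \<alpha> \<beta>"
    using assms by (auto simp: cyclic_algebra_def)
  have rel: "free_eval scale X Y f = 0" if "f \<in> cyclic_relators 5 \<rho> \<alpha> \<beta>" for f
    using that ker hull_subset[of "cyclic_relators 5 \<rho> \<alpha> \<beta>" two_sided_ideal] by blast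
  note free_defs = free_X_def free_Y_def free_const_def mult_single plus_free_word_def
    zero_free_word_def free_eval_diff free_eval_single word_eval_def
  have X5: "X ^ 5 = scale \<alpha> 1"
    using rel[of "free_X ^ 5 - free_const \<alpha>"]
    by (simp add: cyclic_relators_def free_defs eval_nat_numeral)
  have Y5: "Y ^ 5 = scale \<beta> 1"
    using rel[of "free_Y ^ 5 - free_const \<beta>"]
    by (simp add: cyclic_relators_def free_defs eval_nat_numeral)
  have YX: "Y * X = scale \<rho> (X * Y)"
    using rel[of "free_Y * free_X - free_const \<rho> * free_X * free_Y"]
    by (simp add: cyclic_relators_def free_defs)
  define S where "S = (\<lambda>(i, j). X ^ i * Y ^ j) ` ({..<5} \<times> {..<5})"
  have in_S: "X ^ i * Y ^ j \<in> span S" if "i < 5" "j < 5" for i j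
    using that by (auto simp: S_def intro!: span_base)
  have X_span: "X * w \<in> span S" if "w \<in> span S" for w
    using that
  proof (induction rule: span_induct_alt)
    case (step c v w)
    then obtain i j where v: "v = X ^ i * Y ^ j" "i < 5" "j < 5" by (auto simp: S_def)
    have "X * v \<in> span S"
    proof (cases "i = 4")
      case True
      then have "X * v = X ^ 5 * Y ^ j" by (simp add: v eval_nat_numeral mult.assoc)
      then show ?thesis using in_S[of 0 j] v X5 by (simp add: scale_mult_left span_scale)
    next
      case False
      then show ?thesis using in_S[of "Suc i" j] v by (simp add: mult.assoc)
    qed
    then show ?case using step by (simp add: distrib_left scale_mult_right span_add span_scale)
  qed (simp add: span_zero)
  have Y_span: "Y * w \<in> span S" if "w \<in> span S" for w
    using that
  proof (induction rule: span_induct_alt)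
    case (step c v w)
    then obtain i j where v: "v = X ^ i * Y ^ j" "i < 5" "j < 5" by (auto simp: S_def)
    have "Y * v = scale (\<rho> ^ i) (X ^ i * Y ^ Suc j)"
      using power_semicommute(2)[OF YX, of i] by (simp add: v scale_mult_left flip: mult.assoc)
    moreover have "X ^ i * Y ^ Suc j \<in> span S"
    proof (cases "j = 4")
      case True
      then show ?thesis using in_S[of i 0] v Y5 by (simp add: scale_mult_right span_scale eval_nat_numeral)
    next
      case False
      then show ?thesis using in_S[of i "Suc j"] v by simp
    qed
    ultimately have "Y * v \<in> span S" by (simp add: span_scale)
    then show ?case using step by (simp add: distrib_left scale_mult_right span_add span_scale)
  qed (simp add: span_zero)
  have word: "prod_list (map (case_gen X Y) gs) \<in> span S" for gs
    using in_S[of 0 0]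
    by (induction gs) (auto intro: X_span Y_span split: gen.split)
  have "w \<in> span S" for w
  proof -
    obtain f where "w = free_eval scale X Y f" using surj by (metis surjD)
    then show ?thesis
      unfolding free_eval_def word_eval_def by (auto intro!: span_sum span_scale word)
  qed
  moreover have "finite S" "card S \<le> 25"
    using card_image_le[of "{..<5::nat} \<times> {..<5::nat}" "\<lambda>(i, j). X ^ i * Y ^ j"]
    by (simp_all add: S_def)
  ultimately show thesis using that by blast
qed

end

section \<open>Translation of labels and weights\<close>

lemma of_nat_5_neq_0:
  assumes "CHAR('f::field) \<noteq> 5"
  shows "of_nat 5 \<noteq> (0::'f)"
proof
  assume "of_nat 5 = (0::'f)"
  then have "CHAR('f) dvd 5" by (simp only: of_nat_eq_0_iff_char_dvd)
  moreover have "prime (5::nat)" by simp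
  ultimately have "CHAR('f) = 1" using assms by (auto simp: prime_nat_iff)
  then have "of_nat 1 = (0::'f)" by (metis of_nat_CHAR)
  then show False by simp
qed

context assoc_algebra
begin

lemma decomposition_is_decomposition:
  assumes "of_nat p \<noteq> (0::'f)" "primitive_root_of_unity p \<rho>" "x \<in> kummer_elements scale p"
  shows "is_decomposition scale p \<rho> x z (decomposition scale p \<rho> x z)"
  unfolding decomposition_def
  by (rule theI'[OF ex1_decomposition[OF assoc_algebra_axioms assms]])

text \<open>The root of unity is some \<open>\<rho> ^ i\<close>, so by uniqueness the decomposition
  is concentrated at i.\<close>

lemma linked_weight_eq_1:
  assumes five: "of_nat 5 \<noteq> (0::'f)" and rho: "primitive_root_of_unity 5 \<rho>"
    and "linked u v"
  shows "weight scale 5 \<rho> u v = 1"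
proof -
  obtain \<mu> where u: "u \<in> kummer_elements scale 5" and v: "v \<in> kummer_elements scale 5"
    and mu: "\<mu> ^ 5 = 1" "v * u = scale \<mu> (u * v)"
    using assms(3) by (auto simp: linked_def)
  have r5: "\<rho> ^ 5 = 1" using rho by (simp add: primitive_root_of_unity_def)
  have r1: "\<rho> \<noteq> 1"
    using rho by (auto simp: primitive_root_of_unity_def dest!: spec[of _ 1])
  have "(\<mu> - 1) * (\<mu> - \<rho>) * (\<mu> - \<rho> ^ 2) * (\<mu> - \<rho> ^ 3) * (\<mu> - \<rho> ^ 4) = 0"
    using sum_fifth_root[OF r5 r1] mu(1) by algebra
  then have "\<mu> = \<rho> ^ 0 \<or> \<mu> = \<rho> ^ 1 \<or> \<mu> = \<rho> ^ 2 \<or> \<mu> = \<rho> ^ 3 \<or> \<mu> = \<rho> ^ 4" by auto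
  then have "\<exists>i\<in>{0, 1, 2, 3, 4}. \<mu> = \<rho> ^ i" by simp
  then obtain i where i: "i \<in> {0, 1, 2, 3, 4::nat}" "\<mu> = \<rho> ^ i" ..
  then have i5: "i < 5" by auto
  define d where "d k = (if k = i then v else 0)" for k
  have "is_decomposition scale 5 \<rho> u v d"
    using i5 mu(2) by (auto simp: is_decomposition_def d_def i(2))
  then have "decomposition scale 5 \<rho> u v = d"
    using decomposition_is_decomposition[OF five rho u]
      ex1_decomposition[OF assoc_algebra_axioms five rho u] by blast
  moreover have "v \<noteq> 0" using v by (auto simp: kummer_elements_def)
  ultimately have "label scale 5 \<rho> u v = {i}" using i5 by (auto simp: label_def d_def)
  then show ?thesis by (simp add: weight_def)
qed

text \<open>The component of index l contributes \<open>z ^ 4 * d l\<close> times the sum of the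
  powers of \<open>\<rho> ^ l\<close>, which is 0 for l \<noteq> 0; the component of index 0
  vanishes by assumption.\<close>

lemma trace_eq_0:
  assumes five: "of_nat 5 \<noteq> (0::'f)" and rho: "primitive_root_of_unity 5 \<rho>"
    and z: "z \<in> kummer_elements scale 5" and "0 \<notin> label scale 5 \<rho> z x"
  shows "(\<Sum>k<5. z ^ k * x * z ^ (4 - k)) = 0"
proof -
  define d where "d = decomposition scale 5 \<rho> z x"
  have d: "x = (\<Sum>l<5. d l)" "\<And>l. l < 5 \<Longrightarrow> d l * z = scale (\<rho> ^ l) (z * d l)"
    using decomposition_is_decomposition[OF five rho z, of x]
    by (auto simp: is_decomposition_def d_def)
  have d0: "d 0 = 0" using assms(4) by (auto simp: label_def d_def)
  have r5: "\<rho> ^ 5 = 1" using rho by (simp add: primitive_root_of_unity_def)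
  have comp: "(\<Sum>k<5. z ^ k * d l * z ^ (4 - k)) = 0" if l: "l < 5" for l
  proof (cases "l = 0")
    case False
    have "z ^ k * d l * z ^ (4 - k) = scale ((\<rho> ^ l) ^ (4 - k)) (z ^ 4 * d l)" if "k < 5" for k
    proof -
      have "z ^ k * d l * z ^ (4 - k) = scale ((\<rho> ^ l) ^ (4 - k)) (z ^ k * z ^ (4 - k) * d l)"
        by (simp add: mult.assoc power_semicommute(2)[OF d(2)[OF l]] scale_mult_right)
      also have "z ^ k * z ^ (4 - k) = z ^ 4" using that by (simp flip: power_add)
      finally show ?thesis .
    qed
    then have "(\<Sum>k<5. z ^ k * d l * z ^ (4 - k))
        = scale (\<Sum>k<5. (\<rho> ^ l) ^ (4 - k)) (z ^ 4 * d l)"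
      by (simp add: scale_sum_left)
    also have "(\<Sum>k<5. (\<rho> ^ l) ^ (4 - k)) = (\<Sum>k<5. (\<rho> ^ l) ^ k)"
      by (rule sum.reindex_bij_witness[of _ "\<lambda>k. 4 - k" "\<lambda>k. 4 - k"]) auto
    also have "\<dots> = 0"
      using fifth_root_power[OF r5, of l] rho l False
      by (intro sum_powers_root_of_unity) (auto simp: primitive_root_of_unity_def)
    finally show ?thesis by simp
  qed (simp add: d0)
  have "(\<Sum>k<5. z ^ k * x * z ^ (4 - k)) = (\<Sum>k<5. \<Sum>l<5. z ^ k * d l * z ^ (4 - k))"
    unfolding d(1) by (simp add: sum_distrib_left sum_distrib_right)
  also have "\<dots> = (\<Sum>l<5. \<Sum>k<5. z ^ k * d l * z ^ (4 - k))" by (rule sum.swap)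
  also have "\<dots> = 0" using comp by simp
  finally show ?thesis .
qed

end

theorem theorem5p1:
  fixes scale :: "'f::field \<Rightarrow> 'a::ring_1 \<Rightarrow> 'a" and \<rho> :: 'f and x z :: 'a
  assumes "CHAR('f) \<noteq> 5"
    and "primitive_root_of_unity 5 \<rho>"
    and "cyclic_algebra scale 5 \<rho>"
    and "x \<in> kummer_elements scale 5"
    and "z \<in> kummer_elements scale 5"
    and "weight scale 5 \<rho> x z = 2"
    and "0 \<notin> label scale 5 \<rho> z x"
  shows "\<exists>n\<ge>1. \<exists>u :: nat \<Rightarrow> 'a.
           u 0 = x \<and> u n = z \<and>
           (\<forall>t\<le>n. u t \<in> kummer_elements scale 5) \<and>
           (\<forall>t<n. weight scale 5 \<rho> (u t) (u (t + 1)) = 1)"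
proof -
  interpret assoc_algebra scale using assms(3) by (simp add: cyclic_algebra_def)
  have five: "of_nat 5 \<noteq> (0::'f)" by (rule of_nat_5_neq_0[OF assms(1)])
  have r5: "\<rho> ^ 5 = 1" using assms(2) by (simp add: primitive_root_of_unity_def)
  have r1: "\<rho> ^ k \<noteq> 1" if "0 < k" "k < 5" for k
    using assms(2) that by (simp add: primitive_root_of_unity_def)
  obtain S where S: "finite S" "card S \<le> 25" "span S = UNIV"
    using cyclic_algebra_spanning_set[OF assms(3)] .
  define d where "d = decomposition scale 5 \<rho> x z"
  have d: "z = (\<Sum>l<5. d l)" "\<And>l. l < 5 \<Longrightarrow> d l * x = scale (\<rho> ^ l) (x * d l)"
    using decomposition_is_decomposition[OF five assms(2,4), of z]
    by (auto simp: is_decomposition_def d_def)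
  have "card (label scale 5 \<rho> x z) = 2" using assms(6) by (simp add: weight_def)
  then obtain i j where ij: "label scale 5 \<rho> x z = {i, j}" "i \<noteq> j" by (auto simp: card_2_iff)
  have lab: "l \<in> {i, j} \<longleftrightarrow> l < 5 \<and> d l \<noteq> 0" for l
    unfolding ij(1)[symmetric] by (simp add: label_def d_def)
  then have i: "i < 5" "d i \<noteq> 0" and j: "j < 5" "d j \<noteq> 0" by auto
  have "z = (\<Sum>l\<in>{i, j}. d l)"
    unfolding d(1) using lab i j by (intro sum.mono_neutral_right) auto
  then have z: "z = d i + d j" using ij(2) by simp
  have "\<rho> ^ i \<noteq> \<rho> ^ j"
  proof
    assume "\<rho> ^ i = \<rho> ^ j"
    then show False
      using fifth_root_power_inj[of \<rho> i j] i j ij(2) r5 r1[of 1] by simp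
  qed
  have "linked\<^sup>+\<^sup>+ x (d i + d j)"
    using five linked_eigencomponents[OF S _ assms(4) fifth_root_power[OF r5] fifth_root_power[OF r5]
        \<open>\<rho> ^ i \<noteq> \<rho> ^ j\<close> d(2)[OF i(1)] d(2)[OF j(1)] i(2) j(2)]
      trace_eq_0[OF five assms(2,5,7)] assms(5) unfolding z by simp
  then obtain n where n: "n > 0" "(linked ^^ n) x z" unfolding tranclp_power z by blast
  then obtain u where u: "u 0 = x" "u n = z" "\<And>t. t < n \<Longrightarrow> linked (u t) (u (Suc t))"
    unfolding relpowp_fun_conv by blast
  \<comment> \<open>The last vertex starts no edge; for it the assumption on \<open>z\<close> is
    used.\<close>
  have "u t \<in> kummer_elements scale 5" if "t \<le> n" for t
    using u(2) u(3)[of t] assms(5) that by (cases "t = n") (auto simp: linked_def)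
  moreover have "weight scale 5 \<rho> (u t) (u (t + 1)) = 1" if "t < n" for t
    using linked_weight_eq_1[OF five assms(2) u(3)[OF that]] by simp
  ultimately show ?thesis using n(1) u(1,2) by (intro exI[of _ n] exI[of _ u] conjI) auto
qed

end
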